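(* The restriction $\mathsf{S}|_{\mathbf{S}}:\mathbf{S}\to\mathbf{K}$, sending a regular prime $\omega$-poset $\mathbb{P}$ to $\mathsf{S}\mathbb{P}$ and a strong refiner $\rho\subseteq\mathbb{Q}\times\mathbb{P}$ to $\phi_\rho:\mathsf{S}\mathbb{P}\to\mathsf{S}\mathbb{Q}$, is a fully faithful essentially surjective functor such that $\mathsf{S}=\mathsf{S}|_{\mathbf{S}}\circ\mathsf{Q}$, where $\mathsf{Q}:\mathbf{P}\to\mathbf{S}$ is the functor (identity on objects) defined on morphisms by $\mathsf{Q}(\rho)={\vartriangleright_{\mathbb{Q}}}*\rho$ for $\rho\subseteq\mathbb{Q}\times\mathbb{P}$.
   Context: Let $(\mathbb{P},\leq)$ be a poset. A subset $S\subseteq\mathbb{P}$ refines $T\subseteq\mathbb{P}$ if for every $s\in S$ there is $t\in T$ with $s\leq t$. A band of $\mathbb{P}$ is a finite subset $B\subseteq\mathbb{P}$ such that every $p\in\mathbb{P}$ is comparable to some $b\in B$. A cap of $\mathbb{P}$ is a subset refined by some band. A selector is a subset $S\subseteq\mathbb{P}$ with $S\cap C\neq\emptyset$ for every cap $C$ of $\mathbb{P}$; a minimal selector is one minimal with respect to inclusion among all selectors. The spectrum $\mathsf{S}\mathbb{P}$ is the set of all minimal selectors, with the topology generated by the subbasis consisting of the sets $p^\in=\{S\in\mathsf{S}\mathbb{P}:p\in S\}$, for $p\in\mathbb{P}$. $\mathbb{P}$ is an $\omega$-poset if every principal filter $p^\leq=\{q\in\mathbb{P}:p\leq q\}$ is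 finite and, for each $n\in\omega$, the number of principal filters of size $n$ is finite. $\mathbb{P}$ is prime if every element of $\mathbb{P}$ lies in some minimal selector. For $p,q\in\mathbb{P}$ write $p\wedge q$ if there is $r\in\mathbb{P}$ with $r\leq p$ and $r\leq q$. For $p\in\mathbb{P}$ and a cap $C$, the star of $p$ in $C$ is $Cp=\{c\in C:c\wedge p\}$. Write $p\vartriangleleft q$, or equivalently $q\vartriangleright_{\mathbb{P}}p$, if there is a cap $C$ of $\mathbb{P}$ such that $c\leq q$ for all $c\in Cp$. The poset $\mathbb{P}$ is regular if for every cap $D$ of $\mathbb{P}$ there is a cap $C$ of $\mathbb{P}$ such that for each $c\in C$ there is $d\in D$ with $c\vartriangleleft d$. A relation $\rho\subseteq\mathbb{Q}\times\mathbb{P}$ between posets is a refiner if for every cap $D$ of $\mathbb{Q}$ there is a cap $C$ of $\mathbb{P}$ such that for every $c\in C$ there is $d\in D$ with $d\,\rho\,c$. It is $\wedge$-preserving if, for all $p,p'\in\mathbb{P}$ and $q,q'\in\mathbb{Q}$, $q\,\rho\,p$, $q'\,\rho\,p'$ and $p\wedge p'$ imply $q\wedge q'$. $\mathbf{K}$ is the category of metrisable compact spaces and continuous maps. $\mathbf{P}$ is the category whose objects are regular prime $\omega$-posets and whose morphisms from $\mathbb{P}$ to $\mathbb{Q}$ are the $\wedge$-preserving refiners $\rho\subseteq\mathbb{Q}\times\mathbb{P}$, with the usual composition of relations $\sigma\circ\rho=\{(r,p):\exists q\ (r\,\sigma\,q\text{ and }q\,\rho\,p)\}$ and identities the equality relations.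 The functor $\mathsf{S}:\mathbf{P}\to\mathbf{K}$ sends $\mathbb{P}$ to $\mathsf{S}\mathbb{P}$ and $\rho\subseteq\mathbb{Q}\times\mathbb{P}$ to the (well-defined, continuous) map $\phi_\rho:\mathsf{S}\mathbb{P}\to\mathsf{S}\mathbb{Q}$ given by \[\phi_\rho(S)=\{q\in\mathbb{Q}:\exists p\in S\ \exists q'\in\mathbb{Q}\ (q'\,\rho\,p\text{ and }q'\vartriangleleft q)\}.\] The star of a relation $\rho\subseteq\mathbb{Q}\times\mathbb{P}$ is the relation $\rho^*\subseteq\mathbb{Q}\times\mathbb{P}$ given by: $q\,\rho^*\,p$ if there is a cap $C$ of $\mathbb{P}$ such that $q\,\rho\,c$ for all $c\in Cp$. The star-composition of $\sigma\subseteq\mathbb{R}\times\mathbb{Q}$ and $\rho\subseteq\mathbb{Q}\times\mathbb{P}$ is $\sigma*\rho=(\sigma\circ\rho)^*$. A morphism $\rho\subseteq\mathbb{Q}\times\mathbb{P}$ of $\mathbf{P}$ is a strong refiner if $\rho={\vartriangleright_{\mathbb{Q}}}*\rho$. $\mathbf{S}$ is the category with the same objects as $\mathbf{P}$ (regular prime $\omega$-posets) but with strong refiners as morphisms, under star-composition, the identity on $\mathbb{P}$ being $\vartriangleright_{\mathbb{P}}$. *)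

theory Defs
  imports "HOL-Analysis.Analysis"
begin

section \<open>Categories and functors\<close>

text \<open>A category is given by hom-sets indexed by pairs of objects, so composition, identities and
  the action of a functor on morphisms receive the objects involved as explicit arguments:
  \<open>composite C X Y Z g f\<close> is the composite of \<open>f : X \<rightarrow> Y\<close> followed by \<open>g : Y \<rightarrow> Z\<close>.\<close>

record ('o, 'm) category =
  obs :: "'o set"
  hom :: "'o \<Rightarrow> 'o \<Rightarrow> 'm set"
  composite :: "'o \<Rightarrow> 'o \<Rightarrow> 'o \<Rightarrow> 'm \<Rightarrow> 'm \<Rightarrow> 'm"
  ident :: "'o \<Rightarrow> 'm"

definition is_category :: "('o, 'm) category \<Rightarrow> bool" where
  "is_category C \<longleftrightarrow>
     (\<forall>X\<in>obs C. ident C X \<in> hom C X X) \<and>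
     (\<forall>X\<in>obs C. \<forall>Y\<in>obs C. \<forall>Z\<in>obs C. \<forall>f\<in>hom C X Y. \<forall>g\<in>hom C Y Z.
        composite C X Y Z g f \<in> hom C X Z) \<and>
     (\<forall>X\<in>obs C. \<forall>Y\<in>obs C. \<forall>f\<in>hom C X Y.
        composite C X X Y f (ident C X) = f \<and> composite C X Y Y (ident C Y) f = f) \<and>
     (\<forall>W\<in>obs C. \<forall>X\<in>obs C. \<forall>Y\<in>obs C. \<forall>Z\<in>obs C.
        \<forall>f\<in>hom C W X. \<forall>g\<in>hom C X Y. \<forall>h\<in>hom C Y Z.
        composite C W Y Z h (composite C W X Y g f) = composite C W X Z (composite C X Y Z h g) f)"

definition isomorphic_obs :: "('o, 'm) category \<Rightarrow> 'o \<Rightarrow> 'o \<Rightarrow> bool" where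
  "isomorphic_obs C X Y \<longleftrightarrow>
     (\<exists>f\<in>hom C X Y. \<exists>g\<in>hom C Y X.
        composite C X Y X g f = ident C X \<and> composite C Y X Y f g = ident C Y)"

record ('o, 'm, 'p, 'n) functor_data =
  on_ob :: "'o \<Rightarrow> 'p"
  on_hom :: "'o \<Rightarrow> 'o \<Rightarrow> 'm \<Rightarrow> 'n"

definition is_functor ::
  "('o, 'm) category \<Rightarrow> ('p, 'n) category \<Rightarrow> ('o, 'm, 'p, 'n) functor_data \<Rightarrow> bool" where
  "is_functor C D F \<longleftrightarrow>
     is_category C \<and> is_category D \<and>
     (\<forall>X\<in>obs C. on_ob F X \<in> obs D) \<and>
     (\<forall>X\<in>obs C. \<forall>Y\<in>obs C. \<forall>f\<in>hom C X Y. on_hom F X Y f \<in> hom D (on_ob F X) (on_ob F Y)) \<and>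
     (\<forall>X\<in>obs C. on_hom F X X (ident C X) = ident D (on_ob F X)) \<and>
     (\<forall>X\<in>obs C. \<forall>Y\<in>obs C. \<forall>Z\<in>obs C. \<forall>f\<in>hom C X Y. \<forall>g\<in>hom C Y Z.
        on_hom F X Z (composite C X Y Z g f) =
        composite D (on_ob F X) (on_ob F Y) (on_ob F Z) (on_hom F Y Z g) (on_hom F X Y f))"

definition full ::
  "('o, 'm) category \<Rightarrow> ('p, 'n) category \<Rightarrow> ('o, 'm, 'p, 'n) functor_data \<Rightarrow> bool" where
  "full C D F \<longleftrightarrow>
     (\<forall>X\<in>obs C. \<forall>Y\<in>obs C. \<forall>g\<in>hom D (on_ob F X) (on_ob F Y). \<exists>f\<in>hom C X Y. on_hom F X Y f = g)"

definition faithful ::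
  "('o, 'm) category \<Rightarrow> ('o, 'm, 'p, 'n) functor_data \<Rightarrow> bool" where
  "faithful C F \<longleftrightarrow> (\<forall>X\<in>obs C. \<forall>Y\<in>obs C. inj_on (on_hom F X Y) (hom C X Y))"

definition essentially_surjective ::
  "('o, 'm) category \<Rightarrow> ('p, 'n) category \<Rightarrow> ('o, 'm, 'p, 'n) functor_data \<Rightarrow> bool" where
  "essentially_surjective C D F \<longleftrightarrow> (\<forall>Y\<in>obs D. \<exists>X\<in>obs C. isomorphic_obs D (on_ob F X) Y)"

definition functor_comp ::
  "('p, 'n, 'q, 'l) functor_data \<Rightarrow> ('o, 'm, 'p, 'n) functor_data \<Rightarrow> ('o, 'm, 'q, 'l) functor_data"
  where
  "functor_comp G F =
     \<lparr>on_ob = (\<lambda>X. on_ob G (on_ob F X)),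
      on_hom = (\<lambda>X Y f. on_hom G (on_ob F X) (on_ob F Y) (on_hom F X Y f))\<rparr>"

text \<open>Equality of functors out of \<open>C\<close>; values outside the objects and hom-sets of \<open>C\<close>
  are irrelevant.\<close>

definition functor_eq ::
  "('o, 'm) category \<Rightarrow> ('o, 'm, 'p, 'n) functor_data \<Rightarrow> ('o, 'm, 'p, 'n) functor_data \<Rightarrow> bool" where
  "functor_eq C F G \<longleftrightarrow>
     (\<forall>X\<in>obs C. on_ob F X = on_ob G X) \<and>
     (\<forall>X\<in>obs C. \<forall>Y\<in>obs C. \<forall>f\<in>hom C X Y. on_hom F X Y f = on_hom G X Y f)"


section \<open>Posets and their spectra\<close>

text \<open>A poset is a relation \<open>P\<close> with \<open>Partial_order P\<close>; its carrier is \<open>Field P\<close>, and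
  \<open>(p, q) \<in> P\<close> means \<open>p \<le> q\<close>. The empty poset is allowed.\<close>

definition refines :: "'a rel \<Rightarrow> 'a set \<Rightarrow> 'a set \<Rightarrow> bool" where
  "refines P S T \<longleftrightarrow> (\<forall>s\<in>S. \<exists>t\<in>T. (s, t) \<in> P)"

definition band :: "'a rel \<Rightarrow> 'a set \<Rightarrow> bool" where
  "band P B \<longleftrightarrow> finite B \<and> B \<subseteq> Field P \<and> (\<forall>p\<in>Field P. \<exists>b\<in>B. (p, b) \<in> P \<or> (b, p) \<in> P)"

definition cap :: "'a rel \<Rightarrow> 'a set \<Rightarrow> bool" where
  "cap P C \<longleftrightarrow> C \<subseteq> Field P \<and> (\<exists>B. band P B \<and> refines P B C)"

definition selector :: "'a rel \<Rightarrow> 'a set \<Rightarrow> bool" where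
  "selector P S \<longleftrightarrow> S \<subseteq> Field P \<and> (\<forall>C. cap P C \<longrightarrow> S \<inter> C \<noteq> {})"

definition minimal_selector :: "'a rel \<Rightarrow> 'a set \<Rightarrow> bool" where
  "minimal_selector P S \<longleftrightarrow> selector P S \<and> (\<forall>T. selector P T \<and> T \<subseteq> S \<longrightarrow> T = S)"

definition spectrum :: "'a rel \<Rightarrow> 'a set set" where
  "spectrum P = {S. minimal_selector P S}"

definition spectrum_nhd :: "'a rel \<Rightarrow> 'a \<Rightarrow> 'a set set" where
  "spectrum_nhd P p = {S \<in> spectrum P. p \<in> S}"

text \<open>\<open>topology_generated_by \<S>\<close> has \<open>\<Union>\<S>\<close> as its space, so the whole spectrum (the empty
  intersection of subbasic sets) is added explicitly to the subbasis.\<close>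

definition spectrum_topology :: "'a rel \<Rightarrow> 'a set topology" where
  "spectrum_topology P =
     topology_generated_by (insert (spectrum P) (spectrum_nhd P ` Field P))"

definition omega_poset :: "'a rel \<Rightarrow> bool" where
  "omega_poset P \<longleftrightarrow> Partial_order P \<and>
     (\<forall>p\<in>Field P. finite (above P p)) \<and>
     (\<forall>n::nat. finite {F \<in> above P ` Field P. card F = n})"

definition prime_poset :: "'a rel \<Rightarrow> bool" where
  "prime_poset P \<longleftrightarrow> (\<forall>p\<in>Field P. \<exists>S. minimal_selector P S \<and> p \<in> S)"

definition meets :: "'a rel \<Rightarrow> 'a \<Rightarrow> 'a \<Rightarrow> bool" where
  "meets P p q \<longleftrightarrow> (\<exists>r. (r, p) \<in> P \<and> (r, q) \<in> P)"

definition cap_star :: "'a rel \<Rightarrow> 'a set \<Rightarrow> 'a \<Rightarrow> 'a set" where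
  "cap_star P C p = {c \<in> C. meets P c p}"

text \<open>\<open>(q, p) \<in> star_above P\<close> is \<open>q \<rhd>\<^sub>P p\<close>, i.e. \<open>p \<lhd> q\<close>: the larger element comes first.\<close>

definition star_above :: "'a rel \<Rightarrow> 'a rel" where
  "star_above P = {(q, p) \<in> Field P \<times> Field P.
     \<exists>C. cap P C \<and> (\<forall>c\<in>cap_star P C p. (c, q) \<in> P)}"

definition regular_poset :: "'a rel \<Rightarrow> bool" where
  "regular_poset P \<longleftrightarrow>
     (\<forall>D. cap P D \<longrightarrow> (\<exists>C. cap P C \<and> (\<forall>c\<in>C. \<exists>d\<in>D. (d, c) \<in> star_above P)))"


section \<open>Refiners\<close>

text \<open>A relation \<open>\<rho> \<subseteq> Q \<times> P\<close> is a potential morphism from \<open>P\<close> to \<open>Q\<close>: \<open>(q, p) \<in> \<rho>\<close> has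
  \<open>q\<close> in the codomain. With this convention \<open>\<sigma> \<circ> \<rho>\<close> is \<open>\<sigma> O \<rho>\<close>.\<close>

definition refiner :: "'a rel \<Rightarrow> 'a rel \<Rightarrow> 'a rel \<Rightarrow> bool" where
  "refiner P Q \<rho> \<longleftrightarrow> \<rho> \<subseteq> Field Q \<times> Field P \<and>
     (\<forall>D. cap Q D \<longrightarrow> (\<exists>C. cap P C \<and> (\<forall>c\<in>C. \<exists>d\<in>D. (d, c) \<in> \<rho>)))"

definition meet_preserving :: "'a rel \<Rightarrow> 'a rel \<Rightarrow> 'a rel \<Rightarrow> bool" where
  "meet_preserving P Q \<rho> \<longleftrightarrow>
     (\<forall>p\<in>Field P. \<forall>p'\<in>Field P. \<forall>q\<in>Field Q. \<forall>q'\<in>Field Q.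
        (q, p) \<in> \<rho> \<longrightarrow> (q', p') \<in> \<rho> \<longrightarrow> meets P p p' \<longrightarrow> meets Q q q')"

definition rel_star :: "'a rel \<Rightarrow> 'a rel \<Rightarrow> 'a rel \<Rightarrow> 'a rel" where
  "rel_star P Q \<rho> = {(q, p) \<in> Field Q \<times> Field P.
     \<exists>C. cap P C \<and> (\<forall>c\<in>cap_star P C p. (q, c) \<in> \<rho>)}"

definition star_comp :: "'a rel \<Rightarrow> 'a rel \<Rightarrow> 'a rel \<Rightarrow> 'a rel \<Rightarrow> 'a rel" where
  "star_comp P R \<sigma> \<rho> = rel_star P R (\<sigma> O \<rho>)"

definition strong_refiner :: "'a rel \<Rightarrow> 'a rel \<Rightarrow> 'a rel \<Rightarrow> bool" where
  "strong_refiner P Q \<rho> \<longleftrightarrow>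
     refiner P Q \<rho> \<and> meet_preserving P Q \<rho> \<and> \<rho> = star_comp P Q (star_above Q) \<rho>"


section \<open>The categories and functors\<close>

definition cat_P :: "('a rel, 'a rel) category" where
  "cat_P = \<lparr>obs = {P. omega_poset P \<and> prime_poset P \<and> regular_poset P},
            hom = (\<lambda>P Q. {\<rho>. refiner P Q \<rho> \<and> meet_preserving P Q \<rho>}),
            composite = (\<lambda>P Q R \<sigma> \<rho>. \<sigma> O \<rho>),
            ident = (\<lambda>P. Id_on (Field P))\<rparr>"

definition cat_S :: "('a rel, 'a rel) category" where
  "cat_S = \<lparr>obs = {P. omega_poset P \<and> prime_poset P \<and> regular_poset P},
            hom = (\<lambda>P Q. {\<rho>. strong_refiner P Q \<rho>}),
            composite = (\<lambda>P Q R \<sigma> \<rho>. star_comp P R \<sigma> \<rho>),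
            ident = star_above\<rparr>"

text \<open>A map out of a space is represented by the function that is \<open>undefined\<close> outside the space, so that
  equality of morphisms is equality of maps.\<close>

definition cat_K :: "('b topology, 'b \<Rightarrow> 'b) category" where
  "cat_K = \<lparr>obs = {X. compact_space X \<and> metrizable_space X},
            hom = (\<lambda>X Y. {f \<in> extensional (topspace X). continuous_map X Y f}),
            composite = (\<lambda>X Y Z g f. compose (topspace X) g f),
            ident = (\<lambda>X. restrict id (topspace X))\<rparr>"

definition spectrum_map :: "'a rel \<Rightarrow> 'a rel \<Rightarrow> 'a rel \<Rightarrow> 'a set \<Rightarrow> 'a set" where
  "spectrum_map P Q \<rho> =
     (\<lambda>S\<in>spectrum P. {q \<in> Field Q. \<exists>p\<in>S. \<exists>q'\<in>Field Q. (q', p) \<in> \<rho> \<and> (q, q') \<in> star_above Q})"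

text \<open>The same assignments give both the functor on \<open>cat_P\<close> and, restricted to strong refiners,
  the functor on \<open>cat_S\<close>; only the source category differs.\<close>

definition functor_S :: "('a rel, 'a rel, 'a set topology, 'a set \<Rightarrow> 'a set) functor_data" where
  "functor_S = \<lparr>on_ob = spectrum_topology, on_hom = spectrum_map\<rparr>"

definition functor_Q :: "('a rel, 'a rel, 'a rel, 'a rel) functor_data" where
  "functor_Q = \<lparr>on_ob = (\<lambda>P. P), on_hom = (\<lambda>P Q \<rho>. star_comp P Q (star_above Q) \<rho>)\<rparr>"

end

theory Submission
  imports Defs
begin

text \<open>Everything rests on a dictionary between relations of posets and maps of spectra. By Zorn's lemma, a
  set of poset elements is a cap if and only if its basic open sets cover the spectrum
  (\<open>cap_iff_covers_spectrum\<close>). In an omega-poset any two caps have a common refinement, hence minimal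
  selectors are down-directed, the sets \<open>spectrum_nhd P p\<close> form a countable base, and the spectrum is
  compact. If the poset is also prime and regular, then \<open>p\<close> and \<open>q\<close> have a common lower bound if and
  only if their basic open sets intersect, the relation \<open>p \<lhd> q\<close> says that the closure of \<open>p\<close> is
  contained in the basic open set of \<open>q\<close>, and the spectrum is Hausdorff, hence metrisable.

  A \<open>\<and>\<close>-preserving refiner \<open>\<rho>\<close> determines \<open>spectrum_map P Q \<rho>\<close> as the only map sending each \<open>S\<close> to a point in the
  closures of all \<open>q\<close> with \<open>q \<rho> p\<close> for some \<open>p \<in> S\<close> (\<open>spectrum_map_eqI\<close>); this gives functoriality on
  \<open>cat_P\<close>. In the other direction a continuous map \<open>f\<close> gives the relation \<open>rel_of_map P Q f\<close> of all
  \<open>(q, p)\<close> such that \<open>f\<close> maps the closure of \<open>p\<close> into the basic open set of \<open>q\<close>. Since the star of a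
  relation has a description in terms of closures (\<open>rel_star_iff\<close>), one finds that the relation of the
  map of \<open>\<rho>\<close> is exactly \<open>\<rhd>\<^sub>Q * \<rho>\<close>, that the identity map has the relation \<open>\<rhd>\<^sub>P\<close>, and that star-composition
  corresponds to composition of maps. Moreover \<open>f\<close> is recovered from its relation. Strong refiners
  are therefore in bijection with continuous maps, and full faithfulness, the category and functor
  laws and the factorisation through \<open>functor_Q\<close> are read off.

  For essential surjectivity, a compact metric space is covered by finitely many balls of radius
  \<open>\<epsilon> n\<close> for each \<open>n\<close>, with radii decreasing rapidly. Formal balls ordered by inclusion of the closed
  ball in the open ball form an omega-poset in which caps are the same as covers (\<open>cap_iff_cover\<close>), and its
  minimal selectors are the sets of balls around the points of the space. As there are
  countably many formal balls, they can be named by elements of any infinite type.\<close>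

section \<open>Compact Hausdorff spaces with a countable base\<close>

text \<open>The pairs \<open>(U, V)\<close> of base elements with the closure of \<open>U\<close> inside \<open>V\<close> are countable in number.
  Urysohn functions for these pairs separate points, and together they embed the space into a
  countable power of the real line.\<close>

lemma compact_Hausdorff_second_countable_imp_metrizable:
  assumes comp: "compact_space X" and haus: "Hausdorff_space X" and sc: "second_countable X"
  shows "metrizable_space X"
proof -
  obtain B where cB: "countable B" and oB: "\<And>V. V \<in> B \<Longrightarrow> openin X V"
    and bB: "\<And>U x. openin X U \<Longrightarrow> x \<in> U \<Longrightarrow> \<exists>V\<in>B. x \<in> V \<and> V \<subseteq> U"
    using sc unfolding second_countable_def by meson
  have norm: "normal_space X" and reg: "regular_space X" and t1: "t1_space X"
    using comp haus
    by (auto simp: compact_Hausdorff_or_regular_imp_normal_space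
        compact_Hausdorff_imp_regular_space Hausdorff_imp_t1_space)
  define I where "I = {(U, V). U \<in> B \<and> V \<in> B \<and> X closure_of U \<subseteq> V}"
  have "countable I"
    by (rule countable_subset[of _ "B \<times> B"]) (auto simp: I_def cB)
  have "\<exists>f. continuous_map X euclideanreal f \<and> f ` (X closure_of U) \<subseteq> {0} \<and>
      f ` (topspace X - V) \<subseteq> {1}" if "(U, V) \<in> I" for U V
  proof (rule Urysohn_lemma_alt[OF norm, of "X closure_of U" "topspace X - V" 0 1])
    show "disjnt (X closure_of U) (topspace X - V)"
      using that by (auto simp: I_def disjnt_def)
    show "closedin X (topspace X - V)"
      using that oB by (auto simp: I_def)
  qed auto
  then have "\<forall>i\<in>I. \<exists>f. continuous_map X euclideanreal f \<and> f ` (X closure_of (fst i)) \<subseteq> {0} \<and>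
      f ` (topspace X - snd i) \<subseteq> {1}"
    by force
  then obtain f where f: "\<And>i. i \<in> I \<Longrightarrow> continuous_map X euclideanreal (f i) \<and>
      f i ` (X closure_of (fst i)) \<subseteq> {0} \<and> f i ` (topspace X - snd i) \<subseteq> {1}"
    by metis
  define e where "e = (\<lambda>x. \<lambda>i\<in>I. f i x)"
  have "continuous_map X (powertop_real I) e"
    unfolding continuous_map_componentwise using f by (auto simp: e_def)
  moreover have "inj_on e (topspace X)"
  proof (rule inj_onI, rule ccontr)
    fix x y assume xy: "x \<in> topspace X" "y \<in> topspace X" "e x = e y" "x \<noteq> y"
    have "openin X (topspace X - {y})"
      using t1 xy by (simp add: closedin_t1_singleton openin_diff)
    then obtain V where V: "V \<in> B" "x \<in> V" "V \<subseteq> topspace X - {y}"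
      using bB xy by blast
    obtain W where W: "openin X W" "x \<in> W" "X closure_of W \<subseteq> V"
    proof -
      have "\<exists>U C. openin X U \<and> closedin X C \<and> x \<in> U \<and> U \<subseteq> C \<and> C \<subseteq> V"
        using reg oB[OF \<open>V \<in> B\<close>] \<open>x \<in> V\<close>
        unfolding neighbourhood_base_of_closedin[symmetric] neighbourhood_base_of by metis
      then show thesis using that by (meson closure_of_minimal order_trans)
    qed
    obtain U where U: "U \<in> B" "x \<in> U" "U \<subseteq> W"
      using bB W by blast
    then have i: "(U, V) \<in> I"
      using V order_trans[OF closure_of_mono[OF \<open>U \<subseteq> W\<close>, of X] W(3)] by (simp add: I_def)
    have "x \<in> X closure_of U"
      using U oB by (meson closure_of_subset openin_subset subsetD)
    then have "f (U, V) x = 0" "f (U, V) y = 1"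
      using f[OF i] V xy by auto
    moreover have "f (U, V) x = f (U, V) y"
      using xy(3) i unfolding e_def by (metis restrict_apply')
    ultimately show False by simp
  qed
  ultimately have "embedding_map X (powertop_real I) e"
    using comp by (intro continuous_imp_embedding_map) (auto simp: Hausdorff_space_product_topology)
  then have "X homeomorphic_space subtopology (powertop_real I) (e ` topspace X)"
    by (rule embedding_map_imp_homeomorphic_space)
  moreover have "metrizable_space (powertop_real I)"
    using \<open>countable I\<close>
    by (simp add: metrizable_space_product_topology metrizable_space_euclidean)
  ultimately show ?thesis
    using homeomorphic_metrizable_space metrizable_space_subtopology by blast
qed

section \<open>Caps and minimal selectors of omega-posets\<close>

lemma cap_refined: "cap P D \<Longrightarrow> refines P D E \<Longrightarrow> E \<subseteq> Field P \<Longrightarrow> trans P \<Longrightarrow> cap P E"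
  unfolding cap_def refines_def by (meson transD)

lemma cap_mono:
  assumes "cap P D" "D \<subseteq> E" "E \<subseteq> Field P"
  shows "cap P E"
  using assms unfolding cap_def refines_def by blast

lemma cap_has_finite_subcap:
  assumes "cap P D"
  obtains E where "finite E" "E \<subseteq> D" "cap P E"
proof -
  obtain B where B: "band P B" "refines P B D" and D: "D \<subseteq> Field P"
    using assms by (auto simp: cap_def)
  then obtain h where h: "\<And>b. b \<in> B \<Longrightarrow> h b \<in> D \<and> (b, h b) \<in> P"
    unfolding refines_def by metis
  show thesis
  proof (rule that)
    show "finite (h ` B)" using B by (simp add: band_def)
    show "h ` B \<subseteq> D" using h by blast
    show "cap P (h ` B)" using B D h unfolding cap_def refines_def by blast
  qed
qed

lemma selector_iff_complement_not_cap:
  "selector P S \<longleftrightarrow> S \<subseteq> Field P \<and> \<not> cap P (Field P - S)"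
proof -
  have "\<not> cap P C" if "\<not> cap P (Field P - S)" "S \<inter> C = {}" for C
    using that cap_mono[of P C "Field P - S"] by (auto simp: cap_def)
  then show ?thesis unfolding selector_def by blast
qed

text \<open>A cap contains a finite cap, so the union of a chain of non-caps is not a cap. Zorn's lemma
  therefore applies to the complements of selectors.\<close>

lemma selector_contains_minimal_selector:
  assumes "selector P S"
  obtains T where "minimal_selector P T" "T \<subseteq> S"
proof -
  define A where "A = {N. Field P - S \<subseteq> N \<and> N \<subseteq> Field P \<and> \<not> cap P N}"
  have "\<exists>M\<in>A. \<forall>N\<in>A. M \<subseteq> N \<longrightarrow> N = M"
  proof (rule subset_Zorn_nonempty)
    show "A \<noteq> {}"
      using assms by (auto simp: A_def selector_iff_complement_not_cap)
    fix C assume C: "C \<noteq> {}" "subset.chain A C"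
    then have "C \<subseteq> A" by (simp add: subset.chain_def)
    have "\<not> cap P (\<Union>C)"
    proof
      assume "cap P (\<Union>C)"
      then obtain E where E: "finite E" "E \<subseteq> \<Union>C" "cap P E"
        by (rule cap_has_finite_subcap)
      then obtain N where "N \<in> C" "E \<subseteq> N"
        using finite_subset_Union_chain[OF E(1,2) C(1), of A] C(2) by blast
      then show False
        using E \<open>C \<subseteq> A\<close> cap_mono[of P E N] by (auto simp: A_def)
    qed
    then show "\<Union>C \<in> A"
      using C \<open>C \<subseteq> A\<close> by (auto simp: A_def)
  qed
  then obtain M where M: "M \<in> A" "\<And>N. N \<in> A \<Longrightarrow> M \<subseteq> N \<Longrightarrow> N = M"
    by blast
  then have "selector P (Field P - M)"
    by (auto simp: selector_iff_complement_not_cap A_def double_diff)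
  moreover have "T = Field P - M" if "selector P T" "T \<subseteq> Field P - M" for T
  proof -
    have "Field P - T \<in> A" "M \<subseteq> Field P - T"
      using that M(1) by (auto simp: A_def selector_iff_complement_not_cap)
    then have "Field P - T = M" using M(2) by blast
    then show ?thesis using that by (auto simp: selector_def)
  qed
  ultimately have "minimal_selector P (Field P - M)"
    by (auto simp: minimal_selector_def)
  then show thesis using that M(1) by (auto simp: A_def)
qed

text \<open>This is the compactness of the spectrum in combinatorial form: caps are exactly the sets whose
  subbasic neighbourhoods cover the spectrum.\<close>

lemma cap_iff_covers_spectrum:
  "cap P D \<longleftrightarrow> D \<subseteq> Field P \<and> (\<forall>S\<in>spectrum P. \<exists>p\<in>D. p \<in> S)"
proof
  assume "cap P D"
  then show "D \<subseteq> Field P \<and> (\<forall>S\<in>spectrum P. \<exists>p\<in>D. p \<in> S)"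
    unfolding spectrum_def minimal_selector_def selector_def cap_def by blast
next
  assume D: "D \<subseteq> Field P \<and> (\<forall>S\<in>spectrum P. \<exists>p\<in>D. p \<in> S)"
  have "\<not> selector P (Field P - D)"
  proof
    assume "selector P (Field P - D)"
    then obtain T where "minimal_selector P T" "T \<subseteq> Field P - D"
      by (rule selector_contains_minimal_selector)
    then show False using D by (auto simp: spectrum_def)
  qed
  then show "cap P D"
    using D by (simp add: selector_iff_complement_not_cap double_diff)
qed

lemma spectrum_subset_Field: "S \<in> spectrum P \<Longrightarrow> p \<in> S \<Longrightarrow> p \<in> Field P"
  by (auto simp: spectrum_def minimal_selector_def selector_def)

lemma spectrum_meets_cap: "S \<in> spectrum P \<Longrightarrow> cap P C \<Longrightarrow> \<exists>c\<in>C. c \<in> S"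
  by (auto simp: cap_iff_covers_spectrum)

lemma spectrum_antichain: "S \<in> spectrum P \<Longrightarrow> T \<in> spectrum P \<Longrightarrow> T \<subseteq> S \<Longrightarrow> T = S"
  by (auto simp: spectrum_def minimal_selector_def)

lemma spectrum_private_cap:
  assumes "S \<in> spectrum P" "p \<in> S"
  obtains C where "cap P C" "S \<inter> C = {p}"
proof -
  have "S - {p} \<noteq> S" using assms(2) by blast
  then have "\<not> selector P (S - {p})" "S \<subseteq> Field P"
    using assms(1) unfolding spectrum_def minimal_selector_def selector_def by blast+
  then obtain C where C: "cap P C" "(S - {p}) \<inter> C = {}"
    unfolding selector_def by blast
  moreover have "S \<inter> C \<noteq> {}"
    using spectrum_meets_cap[OF assms(1) C(1)] by blast
  ultimately have "S \<inter> C = {p}" by blast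
  then show thesis by (rule that[OF C(1)])
qed

locale omega_ordered =
  fixes P :: "'a rel"
  assumes omega: "omega_poset P"
begin

lemma self_le: "p \<in> Field P \<Longrightarrow> (p, p) \<in> P"
  and transitive: "trans P"
  and antisymmetric: "antisym P"
  using omega by (auto simp: omega_poset_def partial_order_on_def preorder_on_def refl_on_def)

lemma le_trans: "(p, q) \<in> P \<Longrightarrow> (q, r) \<in> P \<Longrightarrow> (p, r) \<in> P"
  using transitive by (meson transD)

lemma le_antisym: "(p, q) \<in> P \<Longrightarrow> (q, p) \<in> P \<Longrightarrow> p = q"
  using antisymmetric by (meson antisymD)

lemma le_Field: "(p, q) \<in> P \<Longrightarrow> p \<in> Field P \<and> q \<in> Field P"
  by (auto simp: Field_def)

lemma meets_sym: "meets P p q \<longleftrightarrow> meets P q p"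
  by (auto simp: meets_def)

lemma finite_card_above: "finite {p \<in> Field P. card (above P p) = n}"
proof -
  have "finite {F \<in> above P ` Field P. card F = n}"
    using omega by (simp add: omega_poset_def)
  moreover have "inj_on (above P) (Field P)"
  proof (rule inj_onI)
    fix p q assume "p \<in> Field P" "q \<in> Field P" "above P p = above P q"
    then have "(p, q) \<in> P" "(q, p) \<in> P" using self_le by (auto simp: above_def set_eq_iff)
    then show "p = q" by (rule le_antisym)
  qed
  moreover have "above P ` {p \<in> Field P. card (above P p) = n} \<subseteq> {F \<in> above P ` Field P. card F = n}"
    by auto
  moreover have "inj_on (above P) {p \<in> Field P. card (above P p) = n}"
    using calculation(2) by (rule inj_on_subset) blast
  ultimately show ?thesis
    using finite_imageD[OF finite_subset] by auto
qed

lemma countable_Field: "countable (Field P)"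
proof -
  have "Field P = (\<Union>n. {p \<in> Field P. card (above P p) = n})" by auto
  moreover have "countable (\<Union>n. {p \<in> Field P. card (above P p) = n})"
    by (rule countable_UN) (auto intro: countable_finite finite_card_above)
  ultimately show ?thesis by simp
qed

text \<open>Enlarge \<open>F\<close> to an up-closed finite set, and further by the maximal elements of its complement.
  The latter are finite in number because their principal filters have bounded size, and every
  element of the complement lies below one of them. The minimal elements of the result form a band,
  and whenever one of them is comparable to some \<open>b \<in> F\<close> it lies below \<open>b\<close> by minimality.\<close>

lemma exists_band_refining_bands:
  assumes "finite F" "F \<subseteq> Field P"
  obtains L where "band P L" "\<And>B. band P B \<Longrightarrow> B \<subseteq> F \<Longrightarrow> refines P L B"
proof -
  define U where "U = (\<Union>p\<in>F. above P p)"
  have finab: "finite (above P p)" if "p \<in> Field P" for p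
    using omega that by (simp add: omega_poset_def)
  have U: "finite U" "F \<subseteq> U" "U \<subseteq> Field P"
    using assms finab self_le le_Field by (auto simp: U_def above_def)
  have Uup: "q \<in> U" if "p \<in> U" "(p, q) \<in> P" for p q
    using that le_trans by (auto simp: U_def above_def)
  define N where "N = {p \<in> Field P - U. \<forall>q. (p, q) \<in> P \<longrightarrow> q = p \<or> q \<in> U}"
  have "finite N"
  proof (rule finite_subset)
    show "N \<subseteq> (\<Union>n\<le>Suc (card U). {p \<in> Field P. card (above P p) = n})"
    proof
      fix p assume p: "p \<in> N"
      then have "above P p \<subseteq> insert p U" by (auto simp: N_def above_def)
      then have "card (above P p) \<le> card (insert p U)"
        using U by (intro card_mono) auto
      also have "\<dots> \<le> Suc (card U)" using U by (simp add: card_insert_if)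
      finally have "card (above P p) \<le> Suc (card U)" .
      then show "p \<in> (\<Union>n\<le>Suc (card U). {p \<in> Field P. card (above P p) = n})"
        using p by (auto simp: N_def)
    qed
  qed (simp add: finite_card_above)
  define G where "G = U \<union> N"
  have G: "finite G" "G \<subseteq> Field P" using U \<open>finite N\<close> by (auto simp: G_def N_def)
  define L where "L = {p \<in> G. \<forall>q\<in>G. (q, p) \<in> P \<longrightarrow> q = p}"
  have above_less: "card (above P q) < card (above P p)" if "(p, q) \<in> P" "p \<noteq> q" for p q
  proof (rule psubset_card_mono)
    show "finite (above P p)" using finab le_Field[OF that(1)] by blast
    have "p \<in> above P p" "p \<notin> above P q"
      using that le_antisym le_Field self_le by (auto simp: above_def)
    moreover have "above P q \<subseteq> above P p"
      using that le_trans by (auto simp: above_def)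
    ultimately show "above P q \<subset> above P p" by blast
  qed
  have below: "\<exists>q\<in>L. (q, p) \<in> P" if "p \<in> G" for p
  proof -
    have "\<exists>q. (q \<in> G \<and> (q, p) \<in> P) \<and>
        (\<forall>r. r \<in> G \<and> (r, p) \<in> P \<longrightarrow> card (above P r) \<le> card (above P q))"
    proof (rule ex_has_greatest_nat)
      show "p \<in> G \<and> (p, p) \<in> P" using that G self_le by blast
      show "\<forall>r. r \<in> G \<and> (r, p) \<in> P \<longrightarrow> card (above P r) < Suc (Max (card ` above P ` G))"
        using G(1) by (simp add: less_Suc_eq_le)
    qed
    then obtain q where q: "q \<in> G" "(q, p) \<in> P"
      "\<And>r. r \<in> G \<Longrightarrow> (r, p) \<in> P \<Longrightarrow> card (above P r) \<le> card (above P q)"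
      by blast
    have "r = q" if "r \<in> G" "(r, q) \<in> P" for r
      using q(3)[OF that(1) le_trans[OF that(2) q(2)]] above_less[OF that(2)] by fastforce
    then show ?thesis using q unfolding L_def by blast
  qed
  have N_below: "\<exists>q\<in>N. (p, q) \<in> P" if "p \<in> Field P" "p \<notin> U" for p
  proof -
    have "\<exists>q. ((p, q) \<in> P \<and> q \<notin> U) \<and>
        (\<forall>r. (p, r) \<in> P \<and> r \<notin> U \<longrightarrow> card (above P q) \<le> card (above P r))"
    proof (rule ex_has_least_nat)
      show "(p, p) \<in> P \<and> p \<notin> U" using that self_le by blast
    qed
    then obtain q where q: "(p, q) \<in> P" "q \<notin> U"
      "\<And>r. (p, r) \<in> P \<Longrightarrow> r \<notin> U \<Longrightarrow> card (above P q) \<le> card (above P r)"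
      by blast
    have "r = q \<or> r \<in> U" if "(q, r) \<in> P" for r
      using q(3)[OF le_trans[OF q(1) that]] above_less[OF that] by fastforce
    then show ?thesis using q le_Field[OF q(1)] unfolding N_def by blast
  qed
  have "N \<subseteq> L"
    using Uup by (auto simp: N_def L_def G_def)
  show thesis
  proof (rule that)
    show "band P L"
      unfolding band_def
    proof (intro conjI ballI)
      show "finite L" "L \<subseteq> Field P" using G by (auto simp: L_def)
      fix p assume "p \<in> Field P"
      then show "\<exists>b\<in>L. (p, b) \<in> P \<or> (b, p) \<in> P"
        using below[of p] N_below[of p] \<open>N \<subseteq> L\<close> by (auto simp: G_def)
    qed
    fix B assume B: "band P B" "B \<subseteq> F"
    show "refines P L B"
      unfolding refines_def
    proof
      fix p assume p: "p \<in> L"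
      then obtain b where b: "b \<in> B" "(p, b) \<in> P \<or> (b, p) \<in> P"
        using B(1) G(2) unfolding band_def L_def by blast
      have "b \<in> G" using b B U by (auto simp: G_def)
      then have "(p, b) \<in> P" using b p by (auto simp: L_def)
      then show "\<exists>b\<in>B. (p, b) \<in> P" using b by blast
    qed
  qed
qed

lemma cap_Field: "cap P (Field P)"
proof -
  obtain L where "band P L" by (rule exists_band_refining_bands[of "{}"]) auto
  then show ?thesis using self_le unfolding cap_def refines_def band_def by blast
qed

lemma caps_have_common_refinement:
  assumes "cap P C" "cap P D"
  obtains E where "cap P E" "refines P E C" "refines P E D"
proof -
  obtain A B where A: "band P A" "refines P A C" and B: "band P B" "refines P B D"
    using assms by (auto simp: cap_def)
  then obtain L where L: "band P L" "refines P L A" "refines P L B"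
    using exists_band_refining_bands[of "A \<union> B"]
    by (metis Un_upper1 Un_upper2 band_def finite_UnI le_supI)
  have "cap P L"
    using L(1) self_le unfolding cap_def refines_def band_def by blast
  moreover have "refines P L C" "refines P L D"
    using L A B le_trans unfolding refines_def by meson+
  ultimately show thesis by (rule that)
qed

lemma spectrum_up_closed:
  assumes S: "S \<in> spectrum P" and "p \<in> S" "(p, q) \<in> P"
  shows "q \<in> S"
proof -
  obtain C where C: "cap P C" "S \<inter> C = {p}"
    by (rule spectrum_private_cap[OF assms(1,2)])
  have sub: "insert q (C - {p}) \<subseteq> Field P"
    using C le_Field[OF assms(3)] by (auto simp: cap_def)
  have "refines P C (insert q (C - {p}))"
    using assms(3) self_le sub by (auto simp: refines_def)
  then have "cap P (insert q (C - {p}))"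
    using cap_refined C(1) sub transitive by blast
  then show ?thesis
    using spectrum_meets_cap[OF S] C(2) by blast
qed

text \<open>A common refinement of two caps that meet \<open>S\<close> only in \<open>p\<close> and only in \<open>q\<close> contains an
  element of \<open>S\<close>, which has no choice but to lie below both \<open>p\<close> and \<open>q\<close>.\<close>

lemma spectrum_down_directed:
  assumes S: "S \<in> spectrum P" and "p \<in> S" "q \<in> S"
  obtains r where "r \<in> S" "(r, p) \<in> P" "(r, q) \<in> P"
proof -
  obtain C where C: "cap P C" "S \<inter> C = {p}"
    by (rule spectrum_private_cap[OF assms(1,2)])
  obtain D where D: "cap P D" "S \<inter> D = {q}"
    by (rule spectrum_private_cap[OF assms(1,3)])
  obtain E where E: "cap P E" "refines P E C" "refines P E D"
    by (rule caps_have_common_refinement[OF C(1) D(1)])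
  obtain r where r: "r \<in> E" "r \<in> S"
    using spectrum_meets_cap[OF S E(1)] by blast
  obtain c d where cd: "c \<in> C" "(r, c) \<in> P" "d \<in> D" "(r, d) \<in> P"
    using E r unfolding refines_def by meson
  then have "c \<in> S" "d \<in> S"
    using spectrum_up_closed[OF S r(2)] by auto
  then have "c = p" "d = q" using cd C D by auto
  then show thesis using that r cd by blast
qed

lemma spectrum_meets: "S \<in> spectrum P \<Longrightarrow> p \<in> S \<Longrightarrow> q \<in> S \<Longrightarrow> meets P p q"
  using spectrum_down_directed unfolding meets_def by metis

lemma spectrum_nonempty: "S \<in> spectrum P \<Longrightarrow> \<exists>p. p \<in> S"
  using spectrum_meets_cap[OF _ cap_Field] by blast

lemma topspace_spectrum: "topspace (spectrum_topology P) = spectrum P"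
  by (auto simp: spectrum_topology_def spectrum_nhd_def)

lemma openin_spectrum_nhd: "p \<in> Field P \<Longrightarrow> openin (spectrum_topology P) (spectrum_nhd P p)"
  by (simp add: spectrum_topology_def topology_generated_by_Basis)

text \<open>Down-directedness of the points turns the subbasis into a base; the full spectrum, as a member of
  the subbasis, is dealt with by the fact that points are nonempty.\<close>

lemma openin_spectrum_iff:
  "openin (spectrum_topology P) U \<longleftrightarrow>
     U \<subseteq> spectrum P \<and> (\<forall>S\<in>U. \<exists>p\<in>S. spectrum_nhd P p \<subseteq> U)"
proof
  assume U: "openin (spectrum_topology P) U"
  then have "U \<subseteq> spectrum P"
    using openin_subset topspace_spectrum by blast
  have "generate_topology_on (insert (spectrum P) (spectrum_nhd P ` Field P)) U"
    using U unfolding spectrum_topology_def openin_topology_generated_by_iff .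
  then have "\<forall>S\<in>U. S \<in> spectrum P \<longrightarrow> (\<exists>p\<in>S. spectrum_nhd P p \<subseteq> U)"
  proof induction
    case (Int A B)
    show ?case
    proof (intro ballI impI)
      fix S assume S: "S \<in> A \<inter> B" "S \<in> spectrum P"
      then obtain p q where pq: "p \<in> S" "spectrum_nhd P p \<subseteq> A" "q \<in> S" "spectrum_nhd P q \<subseteq> B"
        using Int by blast
      obtain r where r: "r \<in> S" "(r, p) \<in> P" "(r, q) \<in> P"
        by (rule spectrum_down_directed[OF S(2) pq(1,3)])
      have "spectrum_nhd P r \<subseteq> A \<inter> B"
        using r pq spectrum_up_closed unfolding spectrum_nhd_def by blast
      then show "\<exists>p\<in>S. spectrum_nhd P p \<subseteq> A \<inter> B" using r by blast
    qed
  next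
    case (Basis A)
    show ?case
    proof (intro ballI impI)
      fix S assume S: "S \<in> A" "S \<in> spectrum P"
      show "\<exists>p\<in>S. spectrum_nhd P p \<subseteq> A"
        using Basis S spectrum_nonempty[OF S(2)] by (auto simp: spectrum_nhd_def)
    qed
  qed blast+
  then show "U \<subseteq> spectrum P \<and> (\<forall>S\<in>U. \<exists>p\<in>S. spectrum_nhd P p \<subseteq> U)"
    using \<open>U \<subseteq> spectrum P\<close> by blast
next
  assume U: "U \<subseteq> spectrum P \<and> (\<forall>S\<in>U. \<exists>p\<in>S. spectrum_nhd P p \<subseteq> U)"
  have "U = (\<Union>p\<in>{p \<in> Field P. spectrum_nhd P p \<subseteq> U}. spectrum_nhd P p)"
  proof
    show "U \<subseteq> (\<Union>p\<in>{p \<in> Field P. spectrum_nhd P p \<subseteq> U}. spectrum_nhd P p)"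
    proof
      fix S assume "S \<in> U"
      then obtain p where "p \<in> S" "spectrum_nhd P p \<subseteq> U" "S \<in> spectrum P" using U by blast
      then show "S \<in> (\<Union>p\<in>{p \<in> Field P. spectrum_nhd P p \<subseteq> U}. spectrum_nhd P p)"
        using spectrum_subset_Field[of S P p] by (auto simp: spectrum_nhd_def)
    qed
  qed blast
  moreover have "openin (spectrum_topology P)
      (\<Union>p\<in>{p \<in> Field P. spectrum_nhd P p \<subseteq> U}. spectrum_nhd P p)"
    using openin_spectrum_nhd by (intro openin_Union) blast
  ultimately show "openin (spectrum_topology P) U" by simp
qed

lemma openin_spectrum_obtains_nhd:
  assumes "openin (spectrum_topology P) U" "S \<in> U"
  obtains p where "p \<in> S" "spectrum_nhd P p \<subseteq> U"
  using assms unfolding openin_spectrum_iff by auto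

lemma compact_spectrum: "compact_space (spectrum_topology P)"
  unfolding compact_space topspace_spectrum
proof (intro allI impI)
  fix \<U> assume \<U>: "(\<forall>U\<in>\<U>. openin (spectrum_topology P) U) \<and> \<Union>\<U> = spectrum P"
  define D where "D = {p \<in> Field P. \<exists>U\<in>\<U>. spectrum_nhd P p \<subseteq> U}"
  have "cap P D"
    unfolding cap_iff_covers_spectrum
  proof (intro conjI ballI)
    fix S assume S: "S \<in> spectrum P"
    then obtain U where U: "U \<in> \<U>" "S \<in> U" using \<U> by blast
    then obtain p where "p \<in> S" "spectrum_nhd P p \<subseteq> U"
      using \<U> openin_spectrum_obtains_nhd by metis
    then show "\<exists>p\<in>D. p \<in> S"
      using U spectrum_subset_Field[OF S] by (auto simp: D_def)
  qed (auto simp: D_def)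
  then obtain E where E: "finite E" "E \<subseteq> D" "cap P E" by (rule cap_has_finite_subcap)
  then have "\<forall>p\<in>E. \<exists>U\<in>\<U>. spectrum_nhd P p \<subseteq> U" by (auto simp: D_def)
  then obtain u where u: "\<And>p. p \<in> E \<Longrightarrow> u p \<in> \<U> \<and> spectrum_nhd P p \<subseteq> u p" by metis
  have "spectrum P \<subseteq> \<Union>(u ` E)"
  proof
    fix S assume S: "S \<in> spectrum P"
    then obtain p where "p \<in> E" "p \<in> S" using spectrum_meets_cap E(3) by blast
    then show "S \<in> \<Union>(u ` E)" using u S by (auto simp: spectrum_nhd_def)
  qed
  moreover have "\<Union>(u ` E) \<subseteq> spectrum P" using u \<U> by blast
  ultimately show "\<exists>\<F>. finite \<F> \<and> \<F> \<subseteq> \<U> \<and> \<Union>\<F> = spectrum P"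
    using E(1) u by (intro exI[of _ "u ` E"]) auto
qed

lemma second_countable_spectrum: "second_countable (spectrum_topology P)"
  unfolding second_countable_def
proof (intro exI[of _ "spectrum_nhd P ` Field P"] conjI allI impI ballI)
  show "countable (spectrum_nhd P ` Field P)" using countable_Field by blast
  show "openin (spectrum_topology P) V" if "V \<in> spectrum_nhd P ` Field P" for V
    using that openin_spectrum_nhd by blast
  fix U S assume U: "openin (spectrum_topology P) U \<and> S \<in> U"
  then have S: "S \<in> spectrum P"
    unfolding openin_spectrum_iff by auto
  obtain p where p: "p \<in> S" "spectrum_nhd P p \<subseteq> U"
    using U openin_spectrum_obtains_nhd by metis
  have "S \<in> spectrum_nhd P p" using S p by (simp add: spectrum_nhd_def)
  then show "\<exists>V\<in>spectrum_nhd P ` Field P. S \<in> V \<and> V \<subseteq> U"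
    using p spectrum_subset_Field[OF S p(1)] by blast
qed

end

section \<open>Regular prime omega-posets\<close>

text \<open>For a prime omega-poset this is the closure of the basic open set \<open>spectrum_nhd P p\<close>: the
  neighbourhoods given by the elements of \<open>S\<close> form a base at \<open>S\<close>, and two basic open sets intersect
  if and only if the corresponding elements meet.\<close>

definition adherent :: "'a rel \<Rightarrow> 'a \<Rightarrow> 'a set set" where
  "adherent P p = {S \<in> spectrum P. \<forall>s\<in>S. meets P s p}"

locale regular_prime_omega = omega_ordered +
  assumes prime: "prime_poset P" and regular: "regular_poset P"
begin

lemma spectrum_nhd_subset_adherent: "S \<in> spectrum P \<Longrightarrow> p \<in> S \<Longrightarrow> S \<in> adherent P p"
  using spectrum_meets by (auto simp: adherent_def)

lemma meets_iff_common_point: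
  "meets P p q \<longleftrightarrow> (\<exists>S\<in>spectrum P. p \<in> S \<and> q \<in> S)"
proof
  assume "meets P p q"
  then obtain r where r: "(r, p) \<in> P" "(r, q) \<in> P" by (auto simp: meets_def)
  then obtain S where "S \<in> spectrum P" "r \<in> S"
    using prime le_Field[OF r(1)] unfolding prime_poset_def spectrum_def by blast
  then show "\<exists>S\<in>spectrum P. p \<in> S \<and> q \<in> S"
    using r spectrum_up_closed by blast
qed (auto intro: spectrum_meets)

text \<open>From left to right, a point in the closure of \<open>p\<close> contains some element of the cap, and this
  element then meets \<open>p\<close>. For the converse, the elements \<open>c\<close> with \<open>q \<tau> c\<close> together with the elements
  that do not meet \<open>p\<close> cover the spectrum, so they form a cap.\<close>

lemma rel_star_iff:
  assumes "\<tau> \<subseteq> Field Q \<times> Field P"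
  shows "(q, p) \<in> rel_star P Q \<tau> \<longleftrightarrow>
    q \<in> Field Q \<and> p \<in> Field P \<and> (\<forall>S\<in>adherent P p. \<exists>c\<in>S. (q, c) \<in> \<tau>)"
proof
  assume "(q, p) \<in> rel_star P Q \<tau>"
  then obtain C where C: "cap P C" "\<forall>c\<in>cap_star P C p. (q, c) \<in> \<tau>"
    and qp: "q \<in> Field Q" "p \<in> Field P"
    by (auto simp: rel_star_def)
  have "\<exists>c\<in>S. (q, c) \<in> \<tau>" if S: "S \<in> adherent P p" for S
  proof -
    have "S \<in> spectrum P" using S by (simp add: adherent_def)
    then obtain c where "c \<in> C" "c \<in> S" using spectrum_meets_cap C(1) by blast
    then show ?thesis using C(2) S by (auto simp: cap_star_def adherent_def)
  qed
  then show "q \<in> Field Q \<and> p \<in> Field P \<and> (\<forall>S\<in>adherent P p. \<exists>c\<in>S. (q, c) \<in> \<tau>)"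
    using qp by blast
next
  assume *: "q \<in> Field Q \<and> p \<in> Field P \<and> (\<forall>S\<in>adherent P p. \<exists>c\<in>S. (q, c) \<in> \<tau>)"
  define C where "C = {c \<in> Field P. \<not> meets P c p \<or> (q, c) \<in> \<tau>}"
  have "cap P C"
    unfolding cap_iff_covers_spectrum
  proof (intro conjI ballI)
    fix S assume S: "S \<in> spectrum P"
    show "\<exists>c\<in>C. c \<in> S"
    proof (cases "S \<in> adherent P p")
      case True
      then obtain c where "c \<in> S" "(q, c) \<in> \<tau>" using * by blast
      then show ?thesis using spectrum_subset_Field[OF S] by (auto simp: C_def)
    next
      case False
      then obtain c where "c \<in> S" "\<not> meets P c p" using S by (auto simp: adherent_def)
      then show ?thesis using spectrum_subset_Field[OF S] by (auto simp: C_def)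
    qed
  qed (simp add: C_def)
  moreover have "\<forall>c\<in>cap_star P C p. (q, c) \<in> \<tau>"
    by (auto simp: cap_star_def C_def)
  ultimately show "(q, p) \<in> rel_star P Q \<tau>"
    using * by (auto simp: rel_star_def)
qed

lemma star_above_iff:
  "(q, p) \<in> star_above P \<longleftrightarrow> q \<in> Field P \<and> p \<in> Field P \<and> (\<forall>S\<in>adherent P p. q \<in> S)"
proof -
  have "star_above P = rel_star P P (P\<inverse>)"
    by (auto simp: star_above_def rel_star_def)
  moreover have "P\<inverse> \<subseteq> Field P \<times> Field P"
    using le_Field by auto
  moreover have "(\<exists>c\<in>S. (c, q) \<in> P) \<longleftrightarrow> q \<in> S" if "S \<in> adherent P p" "q \<in> Field P" for S
    using that self_le spectrum_up_closed by (auto simp: adherent_def)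
  ultimately show ?thesis
    using rel_star_iff[of "P\<inverse>" P q p] by auto
qed

text \<open>Roundness of the points, which makes the closures of basic open sets a neighbourhood base: a cap
  that meets \<open>S\<close> only in \<open>q\<close> is \<open>\<lhd>\<close>-refined by another cap, and the element of \<open>S\<close> in the latter has
  no choice but to be \<open>\<lhd> q\<close>.\<close>

lemma spectrum_round:
  assumes S: "S \<in> spectrum P" and "q \<in> S"
  obtains p where "p \<in> S" "(q, p) \<in> star_above P"
proof -
  obtain C where C: "cap P C" "S \<inter> C = {q}"
    by (rule spectrum_private_cap[OF assms])
  obtain D where D: "cap P D" "\<forall>d\<in>D. \<exists>c\<in>C. (c, d) \<in> star_above P"
    using regular C(1) unfolding regular_poset_def by blast
  obtain p where p: "p \<in> D" "p \<in> S" using spectrum_meets_cap[OF S D(1)] by blast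
  then obtain c where c: "c \<in> C" "(c, p) \<in> star_above P" using D(2) by blast
  then have "c \<in> S"
    using spectrum_nhd_subset_adherent[OF S p(2)] unfolding star_above_iff by blast
  then have "c = q" using c C by blast
  then show thesis using that p c by blast
qed

text \<open>Given \<open>q \<in> S\<close>, roundness yields \<open>p \<in> S\<close> with \<open>p \<lhd> q\<close>. The point \<open>T\<close> lies in the closure of \<open>p\<close>,
  hence contains \<open>q\<close>.\<close>

lemma spectrum_eqI:
  assumes S: "S \<in> spectrum P" and T: "T \<in> spectrum P"
    and meet: "\<And>s t. s \<in> S \<Longrightarrow> t \<in> T \<Longrightarrow> meets P s t"
  shows "S = T"
proof (rule spectrum_antichain[OF T S])
  show "S \<subseteq> T"
  proof
    fix q assume "q \<in> S"
    then obtain p where p: "p \<in> S" "(q, p) \<in> star_above P" by (rule spectrum_round[OF S])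
    have "T \<in> adherent P p"
      using meet[OF p(1)] T meets_sym by (auto simp: adherent_def)
    then show "q \<in> T" using p(2) by (auto simp: star_above_iff)
  qed
qed

lemma Hausdorff_spectrum: "Hausdorff_space (spectrum_topology P)"
  unfolding Hausdorff_space_def topspace_spectrum
proof (intro allI impI)
  fix S T assume *: "S \<in> spectrum P \<and> T \<in> spectrum P \<and> S \<noteq> T"
  then have S: "S \<in> spectrum P" and T: "T \<in> spectrum P" by simp_all
  obtain s t where st: "s \<in> S" "t \<in> T" "\<not> meets P s t"
    using spectrum_eqI[OF S T] * by blast
  have "disjnt (spectrum_nhd P s) (spectrum_nhd P t)"
    using st meets_iff_common_point by (auto simp: disjnt_def spectrum_nhd_def)
  moreover have "S \<in> spectrum_nhd P s" "T \<in> spectrum_nhd P t" "s \<in> Field P" "t \<in> Field P"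
    using S T st spectrum_subset_Field[OF S] spectrum_subset_Field[OF T]
    by (auto simp: spectrum_nhd_def)
  ultimately show "\<exists>U V. openin (spectrum_topology P) U \<and> openin (spectrum_topology P) V \<and>
      S \<in> U \<and> T \<in> V \<and> disjnt U V"
    using openin_spectrum_nhd by blast
qed

lemma metrizable_spectrum: "metrizable_space (spectrum_topology P)"
  using compact_Hausdorff_second_countable_imp_metrizable compact_spectrum Hausdorff_spectrum
    second_countable_spectrum by blast

lemma adherent_inside_open:
  assumes U: "openin (spectrum_topology P) U" and S: "S \<in> U"
  obtains p where "p \<in> S" "adherent P p \<subseteq> U"
proof -
  obtain q where q: "q \<in> S" "spectrum_nhd P q \<subseteq> U"
    by (rule openin_spectrum_obtains_nhd[OF U S])
  have "S \<in> spectrum P" using U S unfolding openin_spectrum_iff by auto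
  then obtain p where p: "p \<in> S" "(q, p) \<in> star_above P"
    using q(1) by (rule spectrum_round)
  then have "adherent P p \<subseteq> spectrum_nhd P q"
    by (auto simp: star_above_iff adherent_def spectrum_nhd_def)
  then show thesis using that p q by blast
qed

text \<open>A criterion for minimality of a selector: a minimal selector \<open>T\<close> inside \<open>F\<close> lies in the closure
  of \<open>q'\<close>, and therefore contains \<open>q\<close>.\<close>

lemma selector_in_spectrumI:
  assumes F: "selector P F"
    and shrink: "\<And>q. q \<in> F \<Longrightarrow> \<exists>q'. (q, q') \<in> star_above P \<and> (\<forall>t\<in>F. meets P t q')"
  shows "F \<in> spectrum P"
proof -
  obtain T where T: "minimal_selector P T" "T \<subseteq> F"
    using F by (rule selector_contains_minimal_selector)
  have "F \<subseteq> T"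
  proof
    fix q assume "q \<in> F"
    then obtain q' where q': "(q, q') \<in> star_above P" "\<forall>t\<in>F. meets P t q'"
      using shrink by blast
    then have "T \<in> adherent P q'"
      using T by (auto simp: adherent_def spectrum_def)
    then show "q \<in> T" using q'(1) by (auto simp: star_above_iff)
  qed
  then show ?thesis using T by (simp add: spectrum_def subset_antisym)
qed

end

section \<open>Continuous maps from refiners and back\<close>

locale meet_preserving_refiner = P: regular_prime_omega P + Q: regular_prime_omega Q
  for P Q :: "'a rel" +
  fixes \<rho> :: "'a rel"
  assumes refiner: "refiner P Q \<rho>" and meet_preserving: "meet_preserving P Q \<rho>"
begin

lemma in_Field: "(q, p) \<in> \<rho> \<Longrightarrow> q \<in> Field Q \<and> p \<in> Field P"
  using refiner by (auto simp: refiner_def)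

lemma in_spectrum_map:
  "S \<in> spectrum P \<Longrightarrow>
    q \<in> spectrum_map P Q \<rho> S \<longleftrightarrow> (\<exists>p\<in>S. \<exists>q'. (q', p) \<in> \<rho> \<and> (q, q') \<in> star_above Q)"
  using in_Field by (auto simp: spectrum_map_def Q.star_above_iff)

text \<open>If \<open>t' \<lhd> t\<close> where \<open>t'\<close> is related to some \<open>p' \<in> S\<close>, then \<open>p'\<close> meets \<open>p\<close>, so \<open>t'\<close> meets \<open>q\<close>. In
  topological terms, the image of \<open>S\<close> lies in the closure of \<open>q\<close>.\<close>

lemma spectrum_map_meets:
  assumes S: "S \<in> spectrum P" and p: "p \<in> S" "(q, p) \<in> \<rho>" and t: "t \<in> spectrum_map P Q \<rho> S"
  shows "meets Q t q"
proof -
  obtain p' t' where t': "p' \<in> S" "(t', p') \<in> \<rho>" "(t, t') \<in> star_above Q"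
    using t in_spectrum_map[OF S] by blast
  have "meets P p' p" by (rule P.spectrum_meets[OF S t'(1) p(1)])
  then have "meets Q t' q"
    using meet_preserving t'(2) p(2) in_Field unfolding meet_preserving_def by blast
  then obtain T where T: "T \<in> spectrum Q" "t' \<in> T" "q \<in> T"
    unfolding Q.meets_iff_common_point by blast
  then have "t \<in> T"
    using t'(3) Q.spectrum_nhd_subset_adherent unfolding Q.star_above_iff by blast
  then show ?thesis using T unfolding Q.meets_iff_common_point by blast
qed

lemma spectrum_map_in_spectrum:
  assumes S: "S \<in> spectrum P"
  shows "spectrum_map P Q \<rho> S \<in> spectrum Q"
proof (rule Q.selector_in_spectrumI)
  show "selector Q (spectrum_map P Q \<rho> S)"
    unfolding selector_def
  proof (intro conjI allI impI)
    show "spectrum_map P Q \<rho> S \<subseteq> Field Q"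
      using in_spectrum_map[OF S] by (auto simp: Q.star_above_iff)
    fix D assume "cap Q D"
    then obtain D' where D': "cap Q D'" "\<forall>c\<in>D'. \<exists>d\<in>D. (d, c) \<in> star_above Q"
      using Q.regular unfolding regular_poset_def by blast
    then obtain C where C: "cap P C" "\<forall>c\<in>C. \<exists>d\<in>D'. (d, c) \<in> \<rho>"
      using refiner unfolding refiner_def by blast
    obtain c where "c \<in> C" "c \<in> S" using spectrum_meets_cap[OF S C(1)] by blast
    then obtain d' d where "(d', c) \<in> \<rho>" "d \<in> D" "(d, d') \<in> star_above Q"
      using C(2) D'(2) by blast
    then have "d \<in> spectrum_map P Q \<rho> S"
      using \<open>c \<in> S\<close> in_spectrum_map[OF S] by blast
    then show "spectrum_map P Q \<rho> S \<inter> D \<noteq> {}" using \<open>d \<in> D\<close> by blast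
  qed
  fix q assume "q \<in> spectrum_map P Q \<rho> S"
  then obtain p q' where "p \<in> S" "(q', p) \<in> \<rho>" "(q, q') \<in> star_above Q"
    using in_spectrum_map[OF S] by blast
  then show "\<exists>q'. (q, q') \<in> star_above Q \<and> (\<forall>t\<in>spectrum_map P Q \<rho> S. meets Q t q')"
    using spectrum_map_meets[OF S] by blast
qed

text \<open>The image of \<open>S\<close> is the only point with the property established above: a point in the closures
  of all \<open>q'\<close> related to elements of \<open>S\<close> contains every \<open>q\<close> with \<open>q' \<lhd> q\<close>. All functoriality
  statements are derived from this uniqueness.\<close>

lemma spectrum_map_eqI:
  assumes S: "S \<in> spectrum P" and T: "T \<in> spectrum Q"
    and meet: "\<And>p q t. p \<in> S \<Longrightarrow> (q, p) \<in> \<rho> \<Longrightarrow> t \<in> T \<Longrightarrow> meets Q t q"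
  shows "spectrum_map P Q \<rho> S = T"
proof (rule spectrum_antichain[OF T spectrum_map_in_spectrum[OF S]])
  show "spectrum_map P Q \<rho> S \<subseteq> T"
  proof
    fix q assume "q \<in> spectrum_map P Q \<rho> S"
    then obtain p q' where q': "p \<in> S" "(q', p) \<in> \<rho>" "(q, q') \<in> star_above Q"
      using in_spectrum_map[OF S] by blast
    then have "T \<in> adherent Q q'" using meet T by (auto simp: adherent_def)
    then show "q \<in> T" using q'(3) by (auto simp: Q.star_above_iff)
  qed
qed

lemma continuous_spectrum_map:
  "continuous_map (spectrum_topology P) (spectrum_topology Q) (spectrum_map P Q \<rho>)"
  unfolding continuous_map_def P.topspace_spectrum Q.topspace_spectrum
proof (intro conjI allI impI)
  show "spectrum_map P Q \<rho> \<in> spectrum P \<rightarrow> spectrum Q"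
    using spectrum_map_in_spectrum by blast
  fix U assume U: "openin (spectrum_topology Q) U"
  show "openin (spectrum_topology P) {S \<in> spectrum P. spectrum_map P Q \<rho> S \<in> U}"
    unfolding P.openin_spectrum_iff
  proof (intro conjI ballI)
    fix S assume "S \<in> {S \<in> spectrum P. spectrum_map P Q \<rho> S \<in> U}"
    then have S: "S \<in> spectrum P" "spectrum_map P Q \<rho> S \<in> U" by auto
    obtain q where q: "q \<in> spectrum_map P Q \<rho> S" "spectrum_nhd Q q \<subseteq> U"
      by (rule Q.openin_spectrum_obtains_nhd[OF U S(2)])
    obtain p q' where p: "p \<in> S" "(q', p) \<in> \<rho>" "(q, q') \<in> star_above Q"
      using q(1) in_spectrum_map[OF S(1)] by blast
    have "spectrum_map P Q \<rho> T \<in> U" if "T \<in> spectrum P" "p \<in> T" for T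
    proof -
      have "q \<in> spectrum_map P Q \<rho> T" using that p in_spectrum_map by blast
      then show ?thesis
        using q(2) spectrum_map_in_spectrum[OF that(1)] by (auto simp: spectrum_nhd_def)
    qed
    then have "spectrum_nhd P p \<subseteq> {S \<in> spectrum P. spectrum_map P Q \<rho> S \<in> U}"
      by (auto simp: spectrum_nhd_def)
    then show "\<exists>p\<in>S. spectrum_nhd P p \<subseteq> {S \<in> spectrum P. spectrum_map P Q \<rho> S \<in> U}"
      using p(1) by blast
  qed blast
qed

end

text \<open>The relation of a map \<open>f\<close> consists of the pairs \<open>(q, p)\<close> such that \<open>f\<close> maps the closure of \<open>p\<close>
  into the basic open set of \<open>q\<close>.\<close>

definition rel_of_map :: "'a rel \<Rightarrow> 'a rel \<Rightarrow> ('a set \<Rightarrow> 'a set) \<Rightarrow> 'a rel" where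
  "rel_of_map P Q f = {(q, p). q \<in> Field Q \<and> p \<in> Field P \<and> (\<forall>S\<in>adherent P p. q \<in> f S)}"

lemma rel_of_map_cong:
  assumes "\<And>S. S \<in> spectrum P \<Longrightarrow> f S = g S"
  shows "rel_of_map P Q f = rel_of_map P Q g"
  using assms by (auto simp: rel_of_map_def adherent_def)

lemma (in regular_prime_omega) star_above_eq_rel_of_id: "star_above P = rel_of_map P P (\<lambda>S. S)"
  using star_above_iff by (auto simp: rel_of_map_def)

text \<open>The star turns the condition that every \<open>S\<close> in the closure of \<open>p\<close> contains some \<open>c\<close> with
  \<open>q \<rhd> q'\<close> and \<open>q' \<rho> c\<close> into a relation between \<open>q\<close> and \<open>p\<close>; that condition says \<open>q \<in> spectrum_map P Q \<rho> S\<close>.\<close>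

lemma (in meet_preserving_refiner) star_comp_star_above:
  "star_comp P Q (star_above Q) \<rho> = rel_of_map P Q (spectrum_map P Q \<rho>)"
proof -
  have "star_above Q O \<rho> \<subseteq> Field Q \<times> Field P"
    using in_Field by (auto simp: Q.star_above_iff)
  moreover have "(\<exists>c\<in>S. (q, c) \<in> star_above Q O \<rho>) \<longleftrightarrow> q \<in> spectrum_map P Q \<rho> S"
    if "S \<in> adherent P p" for S p q
    using that in_spectrum_map[of S q] by (auto simp: adherent_def)
  ultimately show ?thesis
    unfolding star_comp_def rel_of_map_def using P.rel_star_iff by auto
qed

text \<open>A continuous map can be recovered from its relation, because every open neighbourhood of a point
  contains the closure of one of its elements.\<close>

lemma rel_of_map_obtains:
  assumes P: "regular_prime_omega P" and Q: "regular_prime_omega Q"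
    and f: "continuous_map (spectrum_topology P) (spectrum_topology Q) f"
    and S: "S \<in> spectrum P" and q: "q \<in> f S"
  obtains p where "p \<in> S" "(q, p) \<in> rel_of_map P Q f"
proof -
  interpret P: regular_prime_omega P by fact
  interpret Q: regular_prime_omega Q by fact
  have fS: "f S \<in> spectrum Q"
    using f S by (auto simp: continuous_map_def P.topspace_spectrum Q.topspace_spectrum)
  have qF: "q \<in> Field Q" by (rule spectrum_subset_Field[OF fS q])
  have "openin (spectrum_topology P) {S \<in> topspace (spectrum_topology P). f S \<in> spectrum_nhd Q q}"
    using f Q.openin_spectrum_nhd[OF qF] by (rule openin_continuous_map_preimage)
  moreover have "S \<in> {S \<in> topspace (spectrum_topology P). f S \<in> spectrum_nhd Q q}"
    using S q fS by (auto simp: P.topspace_spectrum spectrum_nhd_def)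
  ultimately obtain p where p: "p \<in> S"
    "adherent P p \<subseteq> {S \<in> topspace (spectrum_topology P). f S \<in> spectrum_nhd Q q}"
    by (rule P.adherent_inside_open)
  then have "(q, p) \<in> rel_of_map P Q f"
    using qF spectrum_subset_Field[OF S p(1)] by (auto simp: rel_of_map_def spectrum_nhd_def)
  then show thesis using that p(1) by blast
qed

lemma meet_preserving_refiner_rel_of_map:
  assumes P: "regular_prime_omega P" and Q: "regular_prime_omega Q"
    and f: "continuous_map (spectrum_topology P) (spectrum_topology Q) f"
  shows "meet_preserving_refiner P Q (rel_of_map P Q f)"
proof -
  interpret P: regular_prime_omega P by fact
  interpret Q: regular_prime_omega Q by fact
  have fS: "f S \<in> spectrum Q" if "S \<in> spectrum P" for S
    using f that by (auto simp: continuous_map_def P.topspace_spectrum Q.topspace_spectrum)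
  have "\<exists>C. cap P C \<and> (\<forall>c\<in>C. \<exists>d\<in>D. (d, c) \<in> rel_of_map P Q f)" if D: "cap Q D" for D
  proof (intro exI[of _ "{c. \<exists>d\<in>D. (d, c) \<in> rel_of_map P Q f}"] conjI)
    show "cap P {c. \<exists>d\<in>D. (d, c) \<in> rel_of_map P Q f}"
      unfolding cap_iff_covers_spectrum
    proof (intro conjI ballI)
      fix S assume S: "S \<in> spectrum P"
      obtain d where d: "d \<in> D" "d \<in> f S" using spectrum_meets_cap[OF fS[OF S] D] by blast
      obtain c where "c \<in> S" "(d, c) \<in> rel_of_map P Q f"
        by (rule rel_of_map_obtains[OF P Q f S d(2)])
      then show "\<exists>c\<in>{c. \<exists>d\<in>D. (d, c) \<in> rel_of_map P Q f}. c \<in> S" using d by blast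
    qed (auto simp: rel_of_map_def)
  qed blast
  then have "refiner P Q (rel_of_map P Q f)"
    by (auto simp: refiner_def rel_of_map_def)
  moreover have "meets Q q q'"
    if q: "(q, p) \<in> rel_of_map P Q f" "(q', p') \<in> rel_of_map P Q f" "meets P p p'" for p p' q q'
  proof -
    obtain S where S: "S \<in> spectrum P" "p \<in> S" "p' \<in> S"
      using q(3) unfolding P.meets_iff_common_point by blast
    then have "q \<in> f S" "q' \<in> f S"
      using q P.spectrum_nhd_subset_adherent by (auto simp: rel_of_map_def)
    then show ?thesis using Q.spectrum_meets[OF fS[OF S(1)]] by blast
  qed
  then have "meet_preserving P Q (rel_of_map P Q f)"
    by (auto simp: meet_preserving_def)
  ultimately show ?thesis by unfold_locales
qed

lemma spectrum_map_rel_of_map: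
  assumes P: "regular_prime_omega P" and Q: "regular_prime_omega Q"
    and f: "continuous_map (spectrum_topology P) (spectrum_topology Q) f"
    and S: "S \<in> spectrum P"
  shows "spectrum_map P Q (rel_of_map P Q f) S = f S"
proof -
  interpret \<rho>: meet_preserving_refiner P Q "rel_of_map P Q f"
    by (rule meet_preserving_refiner_rel_of_map[OF P Q f])
  have fS: "f S \<in> spectrum Q"
    using f S by (auto simp: continuous_map_def \<rho>.P.topspace_spectrum \<rho>.Q.topspace_spectrum)
  show ?thesis
  proof (rule \<rho>.spectrum_map_eqI[OF S fS])
    fix p q t assume "p \<in> S" "(q, p) \<in> rel_of_map P Q f" "t \<in> f S"
    then have "q \<in> f S"
      using \<rho>.P.spectrum_nhd_subset_adherent[OF S] by (auto simp: rel_of_map_def)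
    then show "meets Q t q" using \<open>t \<in> f S\<close> fS by (intro \<rho>.Q.spectrum_meets)
  qed
qed

text \<open>Star-composition corresponds to composition of maps: given \<open>g (f S) \<in> spectrum_nhd R r\<close>, an
  intermediate \<open>q \<in> f S\<close> whose closure is mapped by \<open>g\<close> into \<open>spectrum_nhd R r\<close> exists by continuity
  of \<open>g\<close>, and then an element of \<open>S\<close> related to \<open>q\<close> exists by continuity of \<open>f\<close>.\<close>

lemma star_comp_rel_of_map:
  assumes P: "regular_prime_omega P" and Q: "regular_prime_omega Q" and R: "regular_prime_omega R"
    and f: "continuous_map (spectrum_topology P) (spectrum_topology Q) f"
    and g: "continuous_map (spectrum_topology Q) (spectrum_topology R) g"
  shows "star_comp P R (rel_of_map Q R g) (rel_of_map P Q f) = rel_of_map P R (\<lambda>S. g (f S))"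
proof -
  interpret P: regular_prime_omega P by fact
  interpret Q: regular_prime_omega Q by fact
  have fS: "f S \<in> spectrum Q" if "S \<in> spectrum P" for S
    using f that by (auto simp: continuous_map_def P.topspace_spectrum Q.topspace_spectrum)
  let ?\<tau> = "rel_of_map Q R g O rel_of_map P Q f"
  have \<tau>: "?\<tau> \<subseteq> Field R \<times> Field P" by (auto simp: rel_of_map_def)
  have "(\<exists>c\<in>S. (r, c) \<in> ?\<tau>) \<longleftrightarrow> r \<in> g (f S)" if S: "S \<in> spectrum P" for S r
  proof
    assume "\<exists>c\<in>S. (r, c) \<in> ?\<tau>"
    then obtain c q where c: "c \<in> S" "(q, c) \<in> rel_of_map P Q f" "(r, q) \<in> rel_of_map Q R g"
      by blast
    then have "q \<in> f S"
      using P.spectrum_nhd_subset_adherent[OF S] by (auto simp: rel_of_map_def)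
    then show "r \<in> g (f S)"
      using c(3) Q.spectrum_nhd_subset_adherent[OF fS[OF S]] by (auto simp: rel_of_map_def)
  next
    assume r: "r \<in> g (f S)"
    obtain q where q: "q \<in> f S" "(r, q) \<in> rel_of_map Q R g"
      by (rule rel_of_map_obtains[OF Q R g fS[OF S] r])
    obtain c where "c \<in> S" "(q, c) \<in> rel_of_map P Q f"
      by (rule rel_of_map_obtains[OF P Q f S q(1)])
    then show "\<exists>c\<in>S. (r, c) \<in> ?\<tau>" using q(2) by blast
  qed
  then have "(\<forall>S\<in>adherent P p. \<exists>c\<in>S. (r, c) \<in> ?\<tau>) \<longleftrightarrow> (\<forall>S\<in>adherent P p. r \<in> g (f S))" for p r
    by (simp add: adherent_def)
  then show ?thesis
    unfolding star_comp_def rel_of_map_def[of P R] using P.rel_star_iff[OF \<tau>] by auto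
qed

text \<open>Since star-composition with \<open>\<rhd>\<^sub>Q\<close> gives the relation of the map of \<open>\<rho>\<close>, the equation that defines
  strong refiners expresses that \<open>\<rho>\<close> is recovered from its own map.\<close>

lemma strong_refiner_iff:
  assumes "regular_prime_omega P" "regular_prime_omega Q"
  shows "strong_refiner P Q \<rho> \<longleftrightarrow>
    meet_preserving_refiner P Q \<rho> \<and> \<rho> = rel_of_map P Q (spectrum_map P Q \<rho>)"
proof -
  have "meet_preserving_refiner P Q \<rho> \<longleftrightarrow> refiner P Q \<rho> \<and> meet_preserving P Q \<rho>"
    using assms by (simp add: meet_preserving_refiner_def meet_preserving_refiner_axioms_def)
  then show ?thesis
    unfolding strong_refiner_def using meet_preserving_refiner.star_comp_star_above by metis
qed

lemma strong_refiner_rel_of_map: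
  assumes "regular_prime_omega P" "regular_prime_omega Q"
    and "continuous_map (spectrum_topology P) (spectrum_topology Q) f"
  shows "strong_refiner P Q (rel_of_map P Q f)"
  using strong_refiner_iff meet_preserving_refiner_rel_of_map spectrum_map_rel_of_map
    rel_of_map_cong assms by metis

section \<open>The categories and functors\<close>

lemma obs_cat_P: "P \<in> obs cat_P \<longleftrightarrow> regular_prime_omega P"
  and obs_cat_S: "P \<in> obs cat_S \<longleftrightarrow> regular_prime_omega P"
  by (auto simp: cat_P_def cat_S_def regular_prime_omega_def omega_ordered_def
      regular_prime_omega_axioms_def)

lemma hom_cat_P:
  assumes "regular_prime_omega P" "regular_prime_omega Q"
  shows "\<rho> \<in> hom cat_P P Q \<longleftrightarrow> meet_preserving_refiner P Q \<rho>"
  using assms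
  by (simp add: cat_P_def meet_preserving_refiner_def meet_preserving_refiner_axioms_def)

lemma hom_cat_S: "\<rho> \<in> hom cat_S P Q \<longleftrightarrow> strong_refiner P Q \<rho>"
  by (simp add: cat_S_def)

lemma is_category_cat_K: "is_category cat_K"
  unfolding is_category_def
proof (intro conjI ballI)
  fix W X Y Z :: "'b topology" and f g h
  assume "f \<in> hom cat_K W X" "g \<in> hom cat_K X Y" "h \<in> hom cat_K Y Z"
  then have "f \<in> topspace W \<rightarrow> topspace X"
    by (auto simp: cat_K_def continuous_map_def)
  then show "composite cat_K W Y Z h (composite cat_K W X Y g f) =
      composite cat_K W X Z (composite cat_K X Y Z h g) f"
    by (auto simp: cat_K_def compose_assoc)
next
  fix X Y :: "'b topology" and f assume f: "f \<in> hom cat_K X Y"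
  then have "f \<in> extensional (topspace X)" "f \<in> topspace X \<rightarrow> topspace Y"
    by (auto simp: cat_K_def continuous_map_def)
  then show "composite cat_K X X Y f (ident cat_K X) = f"
    "composite cat_K X Y Y (ident cat_K Y) f = f"
    by (auto simp: cat_K_def compose_def extensional_def fun_eq_iff)
next
  fix X Y Z :: "'b topology" and f g assume "f \<in> hom cat_K X Y" "g \<in> hom cat_K Y Z"
  then show "composite cat_K X Y Z g f \<in> hom cat_K X Z"
    by (auto simp: cat_K_def compose_extensional compose_eq
        intro: continuous_map_eq[OF continuous_map_compose])
next
  fix X :: "'b topology"
  show "ident cat_K X \<in> hom cat_K X X"
    by (auto simp: cat_K_def intro: continuous_map_eq[OF continuous_map_id])
qed

lemma spectrum_topology_in_cat_K:
  "regular_prime_omega P \<Longrightarrow> spectrum_topology P \<in> obs cat_K"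
  by (simp add: cat_K_def regular_prime_omega.metrizable_spectrum omega_ordered.compact_spectrum
      regular_prime_omega_def)

lemma topspace_spectrum_topology: "regular_prime_omega P \<Longrightarrow> topspace (spectrum_topology P) = spectrum P"
  by (simp add: omega_ordered.topspace_spectrum regular_prime_omega_def)

lemma spectrum_map_extensional: "spectrum_map P Q \<rho> \<in> extensional (spectrum P)"
  by (simp add: spectrum_map_def)

lemma (in meet_preserving_refiner) spectrum_map_in_cat_K:
  "spectrum_map P Q \<rho> \<in> hom cat_K (spectrum_topology P) (spectrum_topology Q)"
  using continuous_spectrum_map spectrum_map_extensional
  by (simp add: cat_K_def P.topspace_spectrum)

lemma meet_preserving_refiner_Id:
  assumes "regular_prime_omega P"
  shows "meet_preserving_refiner P P (Id_on (Field P))"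
proof -
  interpret P: regular_prime_omega P by fact
  show ?thesis
  proof unfold_locales
    show "refiner P P (Id_on (Field P))"
      unfolding refiner_def
    proof (intro conjI allI impI)
      fix D assume D: "cap P D"
      then have "D \<subseteq> Field P" by (simp add: cap_def)
      then show "\<exists>C. cap P C \<and> (\<forall>c\<in>C. \<exists>d\<in>D. (d, c) \<in> Id_on (Field P))"
        using D by (intro exI[of _ D]) auto
    qed auto
    show "meet_preserving P P (Id_on (Field P))"
      by (auto simp: meet_preserving_def)
  qed
qed

lemma spectrum_map_Id:
  assumes P: "regular_prime_omega P" and S: "S \<in> spectrum P"
  shows "spectrum_map P P (Id_on (Field P)) S = S"
proof -
  interpret \<rho>: meet_preserving_refiner P P "Id_on (Field P)"
    by (rule meet_preserving_refiner_Id[OF P])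
  show ?thesis
    by (rule \<rho>.spectrum_map_eqI[OF S S]) (auto intro: \<rho>.P.spectrum_meets[OF S])
qed

lemma meet_preserving_refiner_comp:
  assumes "meet_preserving_refiner P Q \<rho>" "meet_preserving_refiner Q R \<sigma>"
  shows "meet_preserving_refiner P R (\<sigma> O \<rho>)"
proof -
  interpret \<rho>: meet_preserving_refiner P Q \<rho> by fact
  interpret \<sigma>: meet_preserving_refiner Q R \<sigma> by fact
  show ?thesis
  proof unfold_locales
    show "refiner P R (\<sigma> O \<rho>)"
      unfolding refiner_def
    proof (intro conjI allI impI)
      show "\<sigma> O \<rho> \<subseteq> Field R \<times> Field P" using \<rho>.in_Field \<sigma>.in_Field by auto
      fix D assume "cap R D"
      then obtain E where E: "cap Q E" "\<forall>e\<in>E. \<exists>d\<in>D. (d, e) \<in> \<sigma>"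
        using \<sigma>.refiner unfolding refiner_def by blast
      then obtain C where "cap P C" "\<forall>c\<in>C. \<exists>e\<in>E. (e, c) \<in> \<rho>"
        using \<rho>.refiner unfolding refiner_def by blast
      then show "\<exists>C. cap P C \<and> (\<forall>c\<in>C. \<exists>d\<in>D. (d, c) \<in> \<sigma> O \<rho>)"
        using E by (intro exI[of _ C]) blast
    qed
    show "meet_preserving P R (\<sigma> O \<rho>)"
      unfolding meet_preserving_def
    proof (intro ballI impI)
      fix p p' r r' assume "(r, p) \<in> \<sigma> O \<rho>" "(r', p') \<in> \<sigma> O \<rho>" and m: "meets P p p'"
      then obtain q q' where q: "(r, q) \<in> \<sigma>" "(q, p) \<in> \<rho>" "(r', q') \<in> \<sigma>" "(q', p') \<in> \<rho>" by blast
      then have "meets Q q q'"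
        using \<rho>.meet_preserving \<rho>.in_Field m unfolding meet_preserving_def by blast
      then show "meets R r r'"
        using q \<sigma>.meet_preserving \<sigma>.in_Field unfolding meet_preserving_def by blast
    qed
  qed
qed

text \<open>For \<open>r \<sigma> q\<close> and \<open>q \<rho> p\<close> with \<open>p \<in> S\<close>, the image of \<open>S\<close> under the first map lies in the closure of
  \<open>q\<close>, so the second map sends it into the closure of \<open>r\<close>. This characterises the map of the composite
  relation.\<close>

lemma spectrum_map_comp:
  assumes \<rho>: "meet_preserving_refiner P Q \<rho>" and \<sigma>: "meet_preserving_refiner Q R \<sigma>"
    and S: "S \<in> spectrum P"
  shows "spectrum_map P R (\<sigma> O \<rho>) S = spectrum_map Q R \<sigma> (spectrum_map P Q \<rho> S)"
proof -
  interpret \<rho>: meet_preserving_refiner P Q \<rho> by fact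
  interpret \<sigma>: meet_preserving_refiner Q R \<sigma> by fact
  interpret \<sigma>\<rho>: meet_preserving_refiner P R "\<sigma> O \<rho>"
    by (rule meet_preserving_refiner_comp[OF \<rho> \<sigma>])
  let ?T = "spectrum_map P Q \<rho> S" and ?U = "spectrum_map Q R \<sigma> (spectrum_map P Q \<rho> S)"
  have T: "?T \<in> spectrum Q" by (rule \<rho>.spectrum_map_in_spectrum[OF S])
  show ?thesis
  proof (rule \<sigma>\<rho>.spectrum_map_eqI[OF S \<sigma>.spectrum_map_in_spectrum[OF T]])
    fix p r t assume p: "p \<in> S" "(r, p) \<in> \<sigma> O \<rho>" and t: "t \<in> ?U"
    then obtain q where q: "(r, q) \<in> \<sigma>" "(q, p) \<in> \<rho>" by blast
    obtain u t' where u: "u \<in> ?T" "(t', u) \<in> \<sigma>" "(t, t') \<in> star_above R"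
      using t \<sigma>.in_spectrum_map[OF T] by blast
    have "meets Q u q" by (rule \<rho>.spectrum_map_meets[OF S p(1) q(2) u(1)])
    then have "meets R t' r"
      using q(1) u(2) \<sigma>.meet_preserving \<sigma>.in_Field unfolding meet_preserving_def by blast
    then obtain V where V: "V \<in> spectrum R" "t' \<in> V" "r \<in> V"
      unfolding \<sigma>.Q.meets_iff_common_point by blast
    then have "t \<in> V"
      using u(3) \<sigma>.Q.spectrum_nhd_subset_adherent unfolding \<sigma>.Q.star_above_iff by blast
    then show "meets R t r" using V unfolding \<sigma>.Q.meets_iff_common_point by blast
  qed
qed

lemma is_category_cat_P: "is_category cat_P"
  unfolding is_category_def
proof (intro conjI ballI)
  fix P :: "'a rel" assume "P \<in> obs cat_P"
  then show "ident cat_P P \<in> hom cat_P P P"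
    using meet_preserving_refiner_Id by (simp add: obs_cat_P hom_cat_P) (simp add: cat_P_def)
next
  fix P Q R :: "'a rel" and \<rho> \<sigma>
  assume "P \<in> obs cat_P" "Q \<in> obs cat_P" "R \<in> obs cat_P" "\<rho> \<in> hom cat_P P Q" "\<sigma> \<in> hom cat_P Q R"
  then have "\<sigma> O \<rho> \<in> hom cat_P P R"
    using meet_preserving_refiner_comp by (auto simp: obs_cat_P hom_cat_P)
  then show "composite cat_P P Q R \<sigma> \<rho> \<in> hom cat_P P R" by (simp add: cat_P_def)
next
  fix P Q :: "'a rel" and \<rho> assume "\<rho> \<in> hom cat_P P Q"
  then have "\<rho> \<subseteq> Field Q \<times> Field P" by (simp add: cat_P_def refiner_def)
  then show "composite cat_P P P Q \<rho> (ident cat_P P) = \<rho>"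
    "composite cat_P P Q Q (ident cat_P Q) \<rho> = \<rho>"
    by (auto simp: cat_P_def)
qed (auto simp: cat_P_def)

lemma is_functor_S_cat_P: "is_functor cat_P cat_K functor_S"
  unfolding is_functor_def
proof (intro conjI ballI)
  fix P :: "'a rel" assume "P \<in> obs cat_P"
  then have P: "regular_prime_omega P" by (simp add: obs_cat_P)
  then show "on_ob functor_S P \<in> obs cat_K"
    using spectrum_topology_in_cat_K by (simp add: functor_S_def)
  have "spectrum_map P P (Id_on (Field P)) = restrict id (spectrum P)"
    by (rule extensionalityI[OF spectrum_map_extensional]) (auto simp: spectrum_map_Id[OF P])
  then show "on_hom functor_S P P (ident cat_P P) = ident cat_K (on_ob functor_S P)"
    by (simp add: functor_S_def cat_P_def cat_K_def topspace_spectrum_topology[OF P])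
next
  fix P Q :: "'a rel" and \<rho> assume "P \<in> obs cat_P" "Q \<in> obs cat_P" "\<rho> \<in> hom cat_P P Q"
  then have "meet_preserving_refiner P Q \<rho>"
    by (simp add: obs_cat_P hom_cat_P)
  then show "on_hom functor_S P Q \<rho> \<in> hom cat_K (on_ob functor_S P) (on_ob functor_S Q)"
    using meet_preserving_refiner.spectrum_map_in_cat_K by (simp add: functor_S_def)
next
  fix P Q R :: "'a rel" and \<rho> \<sigma>
  assume "P \<in> obs cat_P" "Q \<in> obs cat_P" "R \<in> obs cat_P" "\<rho> \<in> hom cat_P P Q" "\<sigma> \<in> hom cat_P Q R"
  then have P: "regular_prime_omega P" and Q: "regular_prime_omega Q" and R: "regular_prime_omega R"
    and \<rho>: "meet_preserving_refiner P Q \<rho>" and \<sigma>: "meet_preserving_refiner Q R \<sigma>"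
    by (auto simp: obs_cat_P hom_cat_P)
  have "spectrum_map P R (\<sigma> O \<rho>) =
      compose (spectrum P) (spectrum_map Q R \<sigma>) (spectrum_map P Q \<rho>)"
    by (rule extensionalityI[OF spectrum_map_extensional compose_extensional])
      (simp add: compose_eq spectrum_map_comp[OF \<rho> \<sigma>])
  then show "on_hom functor_S P R (composite cat_P P Q R \<sigma> \<rho>) =
      composite cat_K (on_ob functor_S P) (on_ob functor_S Q) (on_ob functor_S R)
        (on_hom functor_S Q R \<sigma>) (on_hom functor_S P Q \<rho>)"
    by (simp add: functor_S_def cat_P_def cat_K_def topspace_spectrum_topology[OF P])
qed (rule is_category_cat_P is_category_cat_K)+

section \<open>Strong refiners\<close>

lemma strong_refinerD:
  assumes "regular_prime_omega P" "regular_prime_omega Q" "strong_refiner P Q \<rho>"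
  shows "meet_preserving_refiner P Q \<rho>" "rel_of_map P Q (spectrum_map P Q \<rho>) = \<rho>"
    "continuous_map (spectrum_topology P) (spectrum_topology Q) (spectrum_map P Q \<rho>)"
  using assms strong_refiner_iff meet_preserving_refiner.continuous_spectrum_map by metis+

lemma strong_refiner_star_comp:
  assumes P: "regular_prime_omega P" and Q: "regular_prime_omega Q" and R: "regular_prime_omega R"
    and \<rho>: "strong_refiner P Q \<rho>" and \<sigma>: "strong_refiner Q R \<sigma>"
  shows "star_comp P R \<sigma> \<rho> = rel_of_map P R (\<lambda>S. spectrum_map Q R \<sigma> (spectrum_map P Q \<rho> S))"
    and "strong_refiner P R (star_comp P R \<sigma> \<rho>)"
    and "S \<in> spectrum P \<Longrightarrow>
      spectrum_map P R (star_comp P R \<sigma> \<rho>) S = spectrum_map Q R \<sigma> (spectrum_map P Q \<rho> S)"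
proof -
  note \<rho>' = strong_refinerD[OF P Q \<rho>] and \<sigma>' = strong_refinerD[OF Q R \<sigma>]
  show eq: "star_comp P R \<sigma> \<rho> = rel_of_map P R (\<lambda>S. spectrum_map Q R \<sigma> (spectrum_map P Q \<rho> S))"
    using star_comp_rel_of_map[OF P Q R \<rho>'(3) \<sigma>'(3)] \<rho>'(2) \<sigma>'(2) by simp
  have cont: "continuous_map (spectrum_topology P) (spectrum_topology R)
      (\<lambda>S. spectrum_map Q R \<sigma> (spectrum_map P Q \<rho> S))"
    using continuous_map_compose[OF \<rho>'(3) \<sigma>'(3)] by (simp add: comp_def)
  show "strong_refiner P R (star_comp P R \<sigma> \<rho>)"
    unfolding eq by (rule strong_refiner_rel_of_map[OF P R cont])
  show "S \<in> spectrum P \<Longrightarrow>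
      spectrum_map P R (star_comp P R \<sigma> \<rho>) S = spectrum_map Q R \<sigma> (spectrum_map P Q \<rho> S)"
    unfolding eq by (rule spectrum_map_rel_of_map[OF P R cont])
qed

lemma strong_refiner_star_above:
  assumes P: "regular_prime_omega P"
  shows "strong_refiner P P (star_above P)"
    and "S \<in> spectrum P \<Longrightarrow> spectrum_map P P (star_above P) S = S"
  using strong_refiner_rel_of_map[OF P P continuous_map_id[unfolded id_def]]
    spectrum_map_rel_of_map[OF P P continuous_map_id[unfolded id_def]]
    regular_prime_omega.star_above_eq_rel_of_id[OF P] by simp_all

text \<open>Every law of \<open>cat_S\<close> is the corresponding law for maps of spectra, transported along the
  correspondence between strong refiners and continuous maps.\<close>

lemma strong_refiner_eqI:
  assumes "regular_prime_omega P" "regular_prime_omega Q" "strong_refiner P Q \<rho>" "strong_refiner P Q \<rho>'"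
    and "\<And>S. S \<in> spectrum P \<Longrightarrow> spectrum_map P Q \<rho> S = spectrum_map P Q \<rho>' S"
  shows "\<rho> = \<rho>'"
proof -
  have "\<rho> = rel_of_map P Q (spectrum_map P Q \<rho>)"
    using strong_refinerD(2)[OF assms(1-3)] by (rule sym)
  also have "\<dots> = rel_of_map P Q (spectrum_map P Q \<rho>')"
    using assms(5) by (rule rel_of_map_cong)
  also have "\<dots> = \<rho>'"
    by (rule strong_refinerD(2)[OF assms(1,2,4)])
  finally show ?thesis .
qed

lemma is_category_cat_S: "is_category cat_S"
  unfolding is_category_def
proof (intro conjI ballI)
  fix P :: "'a rel" assume "P \<in> obs cat_S"
  then show "ident cat_S P \<in> hom cat_S P P"
    using strong_refiner_star_above by (auto simp: obs_cat_S) (simp add: cat_S_def)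
next
  fix P Q R :: "'a rel" and \<rho> \<sigma>
  assume "P \<in> obs cat_S" "Q \<in> obs cat_S" "R \<in> obs cat_S" "\<rho> \<in> hom cat_S P Q" "\<sigma> \<in> hom cat_S Q R"
  then have "star_comp P R \<sigma> \<rho> \<in> hom cat_S P R"
    using strong_refiner_star_comp(2) by (auto simp: obs_cat_S hom_cat_S)
  then show "composite cat_S P Q R \<sigma> \<rho> \<in> hom cat_S P R" by (simp add: cat_S_def)
next
  fix P Q :: "'a rel" and \<rho> assume "P \<in> obs cat_S" "Q \<in> obs cat_S" "\<rho> \<in> hom cat_S P Q"
  then have P: "regular_prime_omega P" and Q: "regular_prime_omega Q" and \<rho>: "strong_refiner P Q \<rho>"
    by (auto simp: obs_cat_S hom_cat_S)
  note idP = strong_refiner_star_above[OF P]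
  have "star_comp P Q \<rho> (star_above P) = \<rho>"
    by (rule strong_refiner_eqI[OF P Q strong_refiner_star_comp(2)[OF P P Q idP(1) \<rho>] \<rho>])
      (simp add: strong_refiner_star_comp(3)[OF P P Q idP(1) \<rho>] idP(2))
  then show "composite cat_S P P Q \<rho> (ident cat_S P) = \<rho>" by (simp add: cat_S_def)
  have "star_comp P Q (star_above Q) \<rho> = \<rho>"
    using \<rho> by (simp add: strong_refiner_def)
  then show "composite cat_S P Q Q (ident cat_S Q) \<rho> = \<rho>" by (simp add: cat_S_def)
next
  fix O' P Q R :: "'a rel" and \<rho> \<sigma> \<tau>
  assume "O' \<in> obs cat_S" "P \<in> obs cat_S" "Q \<in> obs cat_S" "R \<in> obs cat_S"
    "\<rho> \<in> hom cat_S O' P" "\<sigma> \<in> hom cat_S P Q" "\<tau> \<in> hom cat_S Q R"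
  then have O: "regular_prime_omega O'" and P: "regular_prime_omega P" and Q: "regular_prime_omega Q"
    and R: "regular_prime_omega R"
    and \<rho>: "strong_refiner O' P \<rho>" and \<sigma>: "strong_refiner P Q \<sigma>" and \<tau>: "strong_refiner Q R \<tau>"
    by (auto simp: obs_cat_S hom_cat_S)
  note \<sigma>\<rho> = strong_refiner_star_comp(2,3)[OF O P Q \<rho> \<sigma>]
    and \<tau>\<sigma> = strong_refiner_star_comp(2,3)[OF P Q R \<sigma> \<tau>]
  have im: "spectrum_map O' P \<rho> S \<in> spectrum P" if "S \<in> spectrum O'" for S
    using strong_refinerD(1)[OF O P \<rho>] that by (rule meet_preserving_refiner.spectrum_map_in_spectrum)
  have "star_comp O' R \<tau> (star_comp O' Q \<sigma> \<rho>) = star_comp O' R (star_comp P R \<tau> \<sigma>) \<rho>"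
    by (rule strong_refiner_eqI[OF O R strong_refiner_star_comp(2)[OF O Q R \<sigma>\<rho>(1) \<tau>]
          strong_refiner_star_comp(2)[OF O P R \<rho> \<tau>\<sigma>(1)]])
      (simp add: strong_refiner_star_comp(3)[OF O Q R \<sigma>\<rho>(1) \<tau>]
        strong_refiner_star_comp(3)[OF O P R \<rho> \<tau>\<sigma>(1)] \<sigma>\<rho>(2) \<tau>\<sigma>(2) im)
  then show "composite cat_S O' Q R \<tau> (composite cat_S O' P Q \<sigma> \<rho>) =
      composite cat_S O' P R (composite cat_S P Q R \<tau> \<sigma>) \<rho>"
    by (simp add: cat_S_def)
qed

lemma is_functor_S_cat_S: "is_functor cat_S cat_K functor_S"
  unfolding is_functor_def
proof (intro conjI ballI)
  fix P :: "'a rel" assume "P \<in> obs cat_S"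
  then have P: "regular_prime_omega P" by (simp add: obs_cat_S)
  then show "on_ob functor_S P \<in> obs cat_K"
    using spectrum_topology_in_cat_K by (simp add: functor_S_def)
  have "spectrum_map P P (star_above P) = restrict id (spectrum P)"
    by (rule extensionalityI[OF spectrum_map_extensional])
      (auto simp: strong_refiner_star_above(2)[OF P])
  then show "on_hom functor_S P P (ident cat_S P) = ident cat_K (on_ob functor_S P)"
    by (simp add: functor_S_def cat_S_def cat_K_def topspace_spectrum_topology[OF P])
next
  fix P Q :: "'a rel" and \<rho> assume "P \<in> obs cat_S" "Q \<in> obs cat_S" "\<rho> \<in> hom cat_S P Q"
  then have "meet_preserving_refiner P Q \<rho>"
    using strong_refinerD(1) by (simp add: obs_cat_S hom_cat_S)
  then show "on_hom functor_S P Q \<rho> \<in> hom cat_K (on_ob functor_S P) (on_ob functor_S Q)"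
    using meet_preserving_refiner.spectrum_map_in_cat_K by (simp add: functor_S_def)
next
  fix P Q R :: "'a rel" and \<rho> \<sigma>
  assume "P \<in> obs cat_S" "Q \<in> obs cat_S" "R \<in> obs cat_S" "\<rho> \<in> hom cat_S P Q" "\<sigma> \<in> hom cat_S Q R"
  then have P: "regular_prime_omega P" and Q: "regular_prime_omega Q" and R: "regular_prime_omega R"
    and \<rho>: "strong_refiner P Q \<rho>" and \<sigma>: "strong_refiner Q R \<sigma>"
    by (auto simp: obs_cat_S hom_cat_S)
  have "spectrum_map P R (star_comp P R \<sigma> \<rho>) =
      compose (spectrum P) (spectrum_map Q R \<sigma>) (spectrum_map P Q \<rho>)"
    by (rule extensionalityI[OF spectrum_map_extensional compose_extensional])
      (simp add: compose_eq strong_refiner_star_comp(3)[OF P Q R \<rho> \<sigma>])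
  then show "on_hom functor_S P R (composite cat_S P Q R \<sigma> \<rho>) =
      composite cat_K (on_ob functor_S P) (on_ob functor_S Q) (on_ob functor_S R)
        (on_hom functor_S Q R \<sigma>) (on_hom functor_S P Q \<rho>)"
    by (simp add: functor_S_def cat_S_def cat_K_def topspace_spectrum_topology[OF P])
qed (rule is_category_cat_S is_category_cat_K)+

lemma full_S: "full cat_S cat_K functor_S"
  unfolding full_def
proof (intro ballI)
  fix P Q :: "'a rel" and g
  assume "P \<in> obs cat_S" "Q \<in> obs cat_S" and g: "g \<in> hom cat_K (on_ob functor_S P) (on_ob functor_S Q)"
  then have P: "regular_prime_omega P" and Q: "regular_prime_omega Q" by (auto simp: obs_cat_S)
  have g': "continuous_map (spectrum_topology P) (spectrum_topology Q) g" "g \<in> extensional (spectrum P)"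
    using g by (auto simp: cat_K_def functor_S_def topspace_spectrum_topology[OF P])
  have "spectrum_map P Q (rel_of_map P Q g) = g"
    by (rule extensionalityI[OF spectrum_map_extensional g'(2)])
      (rule spectrum_map_rel_of_map[OF P Q g'(1)])
  then show "\<exists>f\<in>hom cat_S P Q. on_hom functor_S P Q f = g"
    using strong_refiner_rel_of_map[OF P Q g'(1)]
    by (intro bexI[of _ "rel_of_map P Q g"]) (simp_all add: functor_S_def hom_cat_S)
qed

lemma faithful_S: "faithful cat_S functor_S"
  unfolding faithful_def
proof (intro ballI inj_onI)
  fix P Q :: "'a rel" and \<rho> \<rho>'
  assume "P \<in> obs cat_S" "Q \<in> obs cat_S" "\<rho> \<in> hom cat_S P Q" "\<rho>' \<in> hom cat_S P Q"
    and "on_hom functor_S P Q \<rho> = on_hom functor_S P Q \<rho>'"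
  then show "\<rho> = \<rho>'"
    using strong_refiner_eqI[of P Q \<rho> \<rho>'] by (simp add: obs_cat_S hom_cat_S functor_S_def)
qed

lemma functor_Q_hom:
  assumes P: "regular_prime_omega P" and Q: "regular_prime_omega Q" and \<rho>: "meet_preserving_refiner P Q \<rho>"
  shows "on_hom functor_Q P Q \<rho> = rel_of_map P Q (spectrum_map P Q \<rho>)"
    and "strong_refiner P Q (on_hom functor_Q P Q \<rho>)"
    and "S \<in> spectrum P \<Longrightarrow> spectrum_map P Q (on_hom functor_Q P Q \<rho>) S = spectrum_map P Q \<rho> S"
proof -
  note cont = meet_preserving_refiner.continuous_spectrum_map[OF \<rho>]
  show eq: "on_hom functor_Q P Q \<rho> = rel_of_map P Q (spectrum_map P Q \<rho>)"
    using meet_preserving_refiner.star_comp_star_above[OF \<rho>] by (simp add: functor_Q_def)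
  show "strong_refiner P Q (on_hom functor_Q P Q \<rho>)"
    unfolding eq by (rule strong_refiner_rel_of_map[OF P Q cont])
  show "S \<in> spectrum P \<Longrightarrow> spectrum_map P Q (on_hom functor_Q P Q \<rho>) S = spectrum_map P Q \<rho> S"
    unfolding eq by (rule spectrum_map_rel_of_map[OF P Q cont])
qed

lemma is_functor_Q: "is_functor cat_P cat_S functor_Q"
  unfolding is_functor_def
proof (intro conjI ballI)
  fix P :: "'a rel" assume "P \<in> obs cat_P"
  then have P: "regular_prime_omega P" by (simp add: obs_cat_P)
  then show "on_ob functor_Q P \<in> obs cat_S" by (simp add: functor_Q_def obs_cat_S)
  have "rel_of_map P P (spectrum_map P P (Id_on (Field P))) = star_above P"
    unfolding regular_prime_omega.star_above_eq_rel_of_id[OF P]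
    by (rule rel_of_map_cong) (rule spectrum_map_Id[OF P])
  then show "on_hom functor_Q P P (ident cat_P P) = ident cat_S (on_ob functor_Q P)"
    using functor_Q_hom(1)[OF P P meet_preserving_refiner_Id[OF P]]
    by (simp add: cat_P_def cat_S_def) (simp add: functor_Q_def)
next
  fix P Q :: "'a rel" and \<rho> assume "P \<in> obs cat_P" "Q \<in> obs cat_P" "\<rho> \<in> hom cat_P P Q"
  then have "strong_refiner P Q (on_hom functor_Q P Q \<rho>)"
    using functor_Q_hom(2) by (auto simp: obs_cat_P hom_cat_P)
  then show "on_hom functor_Q P Q \<rho> \<in> hom cat_S (on_ob functor_Q P) (on_ob functor_Q Q)"
    by (simp add: hom_cat_S) (simp add: functor_Q_def)
next
  fix P Q R :: "'a rel" and \<rho> \<sigma>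
  assume "P \<in> obs cat_P" "Q \<in> obs cat_P" "R \<in> obs cat_P" "\<rho> \<in> hom cat_P P Q" "\<sigma> \<in> hom cat_P Q R"
  then have P: "regular_prime_omega P" and Q: "regular_prime_omega Q" and R: "regular_prime_omega R"
    and \<rho>: "meet_preserving_refiner P Q \<rho>" and \<sigma>: "meet_preserving_refiner Q R \<sigma>"
    by (auto simp: obs_cat_P hom_cat_P)
  note \<sigma>\<rho> = meet_preserving_refiner_comp[OF \<rho> \<sigma>]
  have im: "spectrum_map P Q \<rho> S \<in> spectrum Q" if "S \<in> spectrum P" for S
    using \<rho> that by (rule meet_preserving_refiner.spectrum_map_in_spectrum)
  let ?Q\<rho> = "on_hom functor_Q P Q \<rho>" and ?Q\<sigma> = "on_hom functor_Q Q R \<sigma>"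
  note comp = strong_refiner_star_comp[OF P Q R functor_Q_hom(2)[OF P Q \<rho>] functor_Q_hom(2)[OF Q R \<sigma>]]
  have "on_hom functor_Q P R (\<sigma> O \<rho>) = star_comp P R ?Q\<sigma> ?Q\<rho>"
    by (rule strong_refiner_eqI[OF P R functor_Q_hom(2)[OF P R \<sigma>\<rho>] comp(2)])
      (simp add: functor_Q_hom(3)[OF P R \<sigma>\<rho>] comp(3) functor_Q_hom(3)[OF P Q \<rho>]
        functor_Q_hom(3)[OF Q R \<sigma>] im spectrum_map_comp[OF \<rho> \<sigma>])
  then show "on_hom functor_Q P R (composite cat_P P Q R \<sigma> \<rho>) =
      composite cat_S (on_ob functor_Q P) (on_ob functor_Q Q) (on_ob functor_Q R)
        (on_hom functor_Q Q R \<sigma>) (on_hom functor_Q P Q \<rho>)"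
    by (simp add: cat_P_def cat_S_def) (simp add: functor_Q_def)
qed (rule is_category_cat_P is_category_cat_S)+

lemma functor_S_factors: "functor_eq cat_P functor_S (functor_comp functor_S functor_Q)"
  unfolding functor_eq_def
proof (intro conjI ballI)
  fix P Q :: "'a rel" and \<rho> assume "P \<in> obs cat_P" "Q \<in> obs cat_P" "\<rho> \<in> hom cat_P P Q"
  then have P: "regular_prime_omega P" and Q: "regular_prime_omega Q"
    and \<rho>: "meet_preserving_refiner P Q \<rho>"
    by (auto simp: obs_cat_P hom_cat_P)
  have "spectrum_map P Q \<rho> = spectrum_map P Q (on_hom functor_Q P Q \<rho>)"
    by (rule extensionalityI[OF spectrum_map_extensional spectrum_map_extensional])
      (simp add: functor_Q_hom(3)[OF P Q \<rho>])
  then show "on_hom functor_S P Q \<rho> = on_hom (functor_comp functor_S functor_Q) P Q \<rho>"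
    by (simp add: functor_comp_def functor_S_def) (simp add: functor_Q_def)
qed (simp add: functor_comp_def functor_S_def functor_Q_def)

section \<open>Every compact metrisable space is a spectrum\<close>

lemma (in Metric_space) compact_has_Lebesgue_number:
  assumes comp: "compact_space mtopology"
    and op: "\<And>U. U \<in> \<U> \<Longrightarrow> openin mtopology U" and cov: "M \<subseteq> \<Union>\<U>"
  obtains \<delta> where "0 < \<delta>" "\<And>x. x \<in> M \<Longrightarrow> \<exists>U\<in>\<U>. mball x \<delta> \<subseteq> U"
proof -
  have "\<exists>r>0. \<exists>U\<in>\<U>. mball x (2 * r) \<subseteq> U" if "x \<in> M" for x
  proof -
    obtain U where U: "U \<in> \<U>" "x \<in> U" using cov \<open>x \<in> M\<close> by blast
    then obtain s where s: "s > 0" "mball x s \<subseteq> U"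
      using op openin_mtopology by blast
    then show ?thesis using U by (intro exI[of _ "s / 2"]) auto
  qed
  then obtain r where r: "\<And>x. x \<in> M \<Longrightarrow> 0 < r x \<and> (\<exists>U\<in>\<U>. mball x (2 * r x) \<subseteq> U)"
    by metis
  have "compactin mtopology M" using comp by (simp add: compact_space_def)
  moreover have "M \<subseteq> \<Union>((\<lambda>x. mball x (r x)) ` M)" using r by fastforce
  ultimately obtain \<F> where \<F>: "finite \<F>" "\<F> \<subseteq> (\<lambda>x. mball x (r x)) ` M" "M \<subseteq> \<Union>\<F>"
    using compactinD[of mtopology M "(\<lambda>x. mball x (r x)) ` M"] by auto
  then obtain X where X: "finite X" "X \<subseteq> M" "\<F> = (\<lambda>x. mball x (r x)) ` X"
    using finite_subset_image by metis
  define \<delta> where "\<delta> = Min (insert 1 (r ` X))"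
  have \<delta>: "\<delta> \<le> r x" if "x \<in> X" for x using X(1) that by (simp add: \<delta>_def)
  have "0 < \<delta>" using X r by (auto simp: \<delta>_def)
  moreover have "\<exists>U\<in>\<U>. mball y \<delta> \<subseteq> U" if y: "y \<in> M" for y
  proof -
    obtain x where x: "x \<in> X" "y \<in> mball x (r x)" using \<F>(3) X(3) y by blast
    then have "mball y \<delta> \<subseteq> mball x (2 * r x)"
      using \<delta>[OF x(1)] by (intro mball_subset) (auto simp: commute)
    then show ?thesis using r x X(2) by (meson order_trans subsetD)
  qed
  ultimately show thesis by (rule that)
qed

text \<open>Formal balls in a compact metric space, arranged in finite levels: the balls of level \<open>n\<close> have
  the radius \<open>\<epsilon> n\<close> and cover the space, and radii decrease so fast that every closed ball of the next
  radius, whatever its centre, lies in an open ball of the current level. A formal ball is below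
  another one if it belongs to a later level and its closed ball lies in the other open ball. Working
  with formal balls rather than with sets makes levels, and hence the finiteness conditions of an
  omega-poset, part of the data.\<close>

locale ball_levels = Metric_space M d for M :: "'b set" and d +
  fixes I :: "'a set" and lev :: "'a \<Rightarrow> nat" and centre :: "'a \<Rightarrow> 'b" and \<epsilon> :: "nat \<Rightarrow> real"
  assumes comp: "compact_space mtopology"
    and eps_pos: "0 < \<epsilon> n" and eps_third: "3 * \<epsilon> (Suc n) \<le> \<epsilon> n"
    and centre: "p \<in> I \<Longrightarrow> centre p \<in> M"
    and finite_level: "finite {p \<in> I. lev p = n}"
    and refine: "x \<in> M \<Longrightarrow>
      \<exists>p\<in>I. lev p = n \<and> mcball x (\<epsilon> (Suc n)) \<subseteq> mball (centre p) (\<epsilon> n)"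
begin

definition oball :: "'a \<Rightarrow> 'b set" where "oball p = mball (centre p) (\<epsilon> (lev p))"
definition clball :: "'a \<Rightarrow> 'b set" where "clball p = mcball (centre p) (\<epsilon> (lev p))"
definition level :: "nat \<Rightarrow> 'a set" where "level n = {p \<in> I. lev p = n}"

definition ball_order :: "'a rel" where
  "ball_order = {(p, q) \<in> I \<times> I. p = q \<or> lev q < lev p \<and> clball p \<subseteq> oball q}"

lemma oball_clball: "oball p \<subseteq> clball p"
  by (auto simp: oball_def clball_def)

lemma oball_subset: "oball p \<subseteq> M"
  by (auto simp: oball_def)

lemma centre_in_oball: "p \<in> I \<Longrightarrow> centre p \<in> oball p"
  using eps_pos centre by (simp add: oball_def)

lemma openin_oball: "openin mtopology (oball p)"
  by (simp add: oball_def)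

lemma eps_mono: "m \<le> n \<Longrightarrow> \<epsilon> n \<le> \<epsilon> m"
proof (rule lift_Suc_antimono_le[of \<epsilon>])
  show "\<epsilon> (Suc k) \<le> \<epsilon> k" for k using eps_third[of k] eps_pos[of "Suc k"] by linarith
qed

lemma eps_small:
  assumes "0 < \<delta>"
  obtains n where "m < n" "4 * \<epsilon> n < \<delta>"
proof -
  have le: "\<epsilon> n \<le> \<epsilon> 0 * (1/3) ^ n" for n
  proof (induction n)
    case (Suc n)
    then show ?case using eps_third[of n] by simp
  qed simp
  have "(\<lambda>n. 4 * (\<epsilon> 0 * (1/3) ^ n)) \<longlonglongrightarrow> 4 * (\<epsilon> 0 * 0)"
    by (intro tendsto_mult tendsto_const LIMSEQ_power_zero) simp
  then have "\<forall>\<^sub>F n in sequentially. 4 * (\<epsilon> 0 * (1/3) ^ n) < \<delta>"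
    using assms by (intro order_tendstoD(2)) auto
  then have "\<forall>\<^sub>F n in sequentially. 4 * (\<epsilon> 0 * (1/3) ^ n) < \<delta> \<and> m < n"
    using eventually_gt_at_top eventually_conj by blast
  then obtain n where "4 * (\<epsilon> 0 * (1/3) ^ n) < \<delta>" "m < n"
    using eventually_happens by force
  then show thesis using le[of n] by (intro that[of n]) linarith+
qed

lemma level_covers:
  assumes "x \<in> M"
  obtains p where "p \<in> level n" "x \<in> oball p"
proof -
  obtain p where p: "p \<in> I" "lev p = n" "mcball x (\<epsilon> (Suc n)) \<subseteq> mball (centre p) (\<epsilon> n)"
    using refine[OF assms] by blast
  have "x \<in> mcball x (\<epsilon> (Suc n))" using assms eps_pos[of "Suc n"] by simp
  then have "x \<in> mball (centre p) (\<epsilon> n)" using p(3) by blast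
  then show thesis using p by (intro that[of p]) (auto simp: level_def oball_def)
qed

lemma level_above:
  assumes p: "p \<in> I" and "m < lev p"
  obtains q where "q \<in> level m" "(p, q) \<in> ball_order"
proof -
  obtain q where q: "q \<in> I" "lev q = m" "mcball (centre p) (\<epsilon> (Suc m)) \<subseteq> mball (centre q) (\<epsilon> m)"
    using refine[OF centre[OF p]] by blast
  have "clball p \<subseteq> mcball (centre p) (\<epsilon> (Suc m))"
    unfolding clball_def using eps_mono[of "Suc m" "lev p"] assms by (intro mcball_subset_concentric) simp
  then show thesis using that[of q] q assms by (auto simp: level_def ball_order_def oball_def)
qed

text \<open>By the triangle inequality through \<open>z\<close> and the centre of \<open>p\<close>, the closed ball of \<open>p\<close> lies within
  distance \<open>3 * \<epsilon> (lev p)\<close> of \<open>x\<close>.\<close>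

lemma ball_order_nearI:
  assumes "p \<in> I" "q \<in> I" "lev q < lev p" "x \<in> M" "mball x \<delta> \<subseteq> oball q"
    and z: "z \<in> oball p" "d x z < \<epsilon> (lev p)" and small: "4 * \<epsilon> (lev p) < \<delta>"
  shows "(p, q) \<in> ball_order"
proof -
  have "clball p \<subseteq> mball x \<delta>"
  proof
    fix y assume y: "y \<in> clball p"
    have m: "z \<in> M" "y \<in> M" "centre p \<in> M" using z y by (auto simp: oball_def clball_def)
    have "d x y \<le> d x z + d z y" using m \<open>x \<in> M\<close> by (intro triangle) auto
    also have "d z y \<le> d z (centre p) + d (centre p) y" using m by (intro triangle) auto
    also have "d z (centre p) < \<epsilon> (lev p)" using z by (simp add: oball_def commute)
    also have "d (centre p) y \<le> \<epsilon> (lev p)" using y by (simp add: clball_def)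
    finally have "d x y < \<delta>" using z(2) small eps_pos[of "lev p"] by linarith
    then show "y \<in> mball x \<delta>" using m \<open>x \<in> M\<close> by simp
  qed
  then show ?thesis using assms by (auto simp: ball_order_def)
qed

text \<open>A closed ball of radius \<open>\<epsilon> n\<close> that contains the centre of \<open>p\<close> stays within \<open>2 * \<epsilon> n\<close> of that
  centre; this is why the radii shrink by a factor of three.\<close>

lemma level_below:
  assumes p: "p \<in> I" and "lev p < n"
  obtains q where "q \<in> level n" "(q, p) \<in> ball_order"
proof -
  obtain q where q: "q \<in> level n" "centre p \<in> oball q"
    by (rule level_covers[OF centre[OF p]])
  have "clball q \<subseteq> oball p"
  proof
    fix y assume y: "y \<in> clball q"
    have qn: "lev q = n" using q by (simp add: level_def)
    have m: "y \<in> M" "centre q \<in> M" "centre p \<in> M"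
      using y q by (auto simp: oball_def clball_def)
    have "d (centre p) y \<le> d (centre p) (centre q) + d (centre q) y"
      using m by (intro triangle) auto
    also have "d (centre p) (centre q) < \<epsilon> n" using q qn by (simp add: oball_def commute)
    also have "d (centre q) y \<le> \<epsilon> n" using y qn by (simp add: clball_def)
    finally have "d (centre p) y < 3 * \<epsilon> n" using eps_pos[of n] by linarith
    moreover have "\<epsilon> (n - 1) \<le> \<epsilon> (lev p)" using \<open>lev p < n\<close> by (intro eps_mono) simp
    then have "3 * \<epsilon> n \<le> \<epsilon> (lev p)"
      using eps_third[of "n - 1"] \<open>lev p < n\<close> by simp
    ultimately show "y \<in> oball p" using m by (simp add: oball_def)
  qed
  then show thesis using that[of q] p q assms by (auto simp: level_def ball_order_def)
qed

lemma ball_order_oball: "(p, q) \<in> ball_order \<Longrightarrow> oball p \<subseteq> oball q"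
  using oball_clball by (auto simp: ball_order_def)

lemma Field_ball_order: "Field ball_order = I"
  by (auto simp: ball_order_def Field_def)

lemma level_subset: "level n \<subseteq> I" by (auto simp: level_def)

lemma omega_poset_ball_order: "omega_poset ball_order"
  unfolding omega_poset_def
proof (intro conjI ballI allI)
  have "trans ball_order"
  proof (rule transI)
    fix p q r assume "(p, q) \<in> ball_order" "(q, r) \<in> ball_order"
    then show "(p, r) \<in> ball_order"
      using oball_clball[of q] by (auto simp: ball_order_def)
  qed
  then show "Partial_order ball_order"
    unfolding partial_order_on_def preorder_on_def refl_on_def Field_ball_order
    by (auto simp: ball_order_def antisym_def)
  have fin: "finite {p \<in> I. lev p \<le> n}" for n
  proof -
    have "{p \<in> I. lev p \<le> n} = (\<Union>k\<le>n. {p \<in> I. lev p = k})" by auto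
    then show ?thesis using finite_level by simp
  qed
  have ab: "above ball_order p \<subseteq> {q \<in> I. lev q \<le> lev p}" for p
    by (auto simp: above_def ball_order_def)
  show "finite (above ball_order p)" for p using ab fin by (rule finite_subset)
  fix n
  \<comment> \<open>Every earlier level contains an element above \<open>p\<close>, so principal filters of size \<open>n\<close> are generated
    by elements of levels below \<open>n\<close>.\<close>
  have card: "lev p < card (above ball_order p)" if p: "p \<in> I" for p
  proof -
    have "{..lev p} \<subseteq> lev ` above ball_order p"
    proof
      fix m assume "m \<in> {..lev p}"
      then consider "m = lev p" | "m < lev p" by fastforce
      then show "m \<in> lev ` above ball_order p"
      proof cases
        case 1
        then show ?thesis using p by (auto simp: above_def ball_order_def)
      next
        case 2
        obtain q where "q \<in> level m" "(p, q) \<in> ball_order" by (rule level_above[OF p 2])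
        then show ?thesis by (auto simp: above_def level_def)
      qed
    qed
    then have "card {..lev p} \<le> card (lev ` above ball_order p)"
      using finite_subset[OF ab fin] by (intro card_mono) auto
    also have "\<dots> \<le> card (above ball_order p)"
      using finite_subset[OF ab fin] by (rule card_image_le)
    finally show ?thesis by simp
  qed
  have "{F \<in> above ball_order ` Field ball_order. card F = n} \<subseteq> above ball_order ` {p \<in> I. lev p \<le> n}"
    using card by (force simp: Field_ball_order)
  then show "finite {F \<in> above ball_order ` Field ball_order. card F = n}"
    using fin finite_subset by blast
qed

sublocale omega_ordered ball_order
  by unfold_locales (rule omega_poset_ball_order)

lemma band_level: "band ball_order (level n)"
  unfolding band_def Field_ball_order
proof (intro conjI ballI)
  show "finite (level n)" using finite_level by (simp add: level_def)
  show "level n \<subseteq> I" by (rule level_subset)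
  fix p assume p: "p \<in> I"
  consider "n < lev p" | "lev p < n" | "lev p = n" by linarith
  then show "\<exists>b\<in>level n. (p, b) \<in> ball_order \<or> (b, p) \<in> ball_order"
  proof cases
    case 1
    then show ?thesis using level_above[OF p] by metis
  next
    case 2
    then show ?thesis using level_below[OF p] by metis
  next
    case 3
    then show ?thesis using p by (auto simp: level_def ball_order_def)
  qed
qed

lemma cap_level: "cap ball_order (level n)"
proof -
  have "refines ball_order (level n) (level n)"
    using level_subset by (auto simp: refines_def ball_order_def)
  then show ?thesis
    using band_level[of n] level_subset by (auto simp: cap_def Field_ball_order)
qed

text \<open>Let \<open>\<delta>\<close> be a Lebesgue number of a finite subcover. If \<open>4 * \<epsilon> n < \<delta>\<close>, then all balls of level \<open>n\<close>
  that intersect \<open>p\<close> lie in the \<open>\<delta>\<close>-ball around the centre of \<open>p\<close>. The level must also be later than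
  those of the subcover, because the order relates distinct balls of different levels only.\<close>

lemma cover_star_refined_by_level:
  assumes D: "D \<subseteq> I" and cov: "M \<subseteq> \<Union>(oball ` D)"
  obtains n where "\<And>p. p \<in> level n \<Longrightarrow>
    \<exists>q\<in>D. \<forall>p'\<in>level n. oball p \<inter> oball p' \<noteq> {} \<longrightarrow> (p', q) \<in> ball_order"
proof -
  have "compactin mtopology M" using comp by (simp add: compact_space_def)
  then obtain \<F> where \<F>: "finite \<F>" "\<F> \<subseteq> oball ` D" "M \<subseteq> \<Union>\<F>"
    using compactinD[of mtopology M "oball ` D"] openin_oball cov by auto
  then obtain E where E: "finite E" "E \<subseteq> D" "\<F> = oball ` E"
    using finite_subset_image by metis
  obtain \<delta> where \<delta>: "0 < \<delta>" "\<And>x. x \<in> M \<Longrightarrow> \<exists>U\<in>oball ` E. mball x \<delta> \<subseteq> U"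
    by (rule compact_has_Lebesgue_number[OF comp, of "oball ` E"]) (use openin_oball \<F> E in auto)
  obtain n where n: "Max (insert 0 (lev ` E)) < n" "4 * \<epsilon> n < \<delta>"
    by (rule eps_small[OF \<delta>(1)])
  have levE: "lev q < n" if "q \<in> E" for q
    using n(1) E(1) that by (simp add: Max_less_iff)
  show thesis
  proof (rule that)
    fix p assume p: "p \<in> level n"
    then have pM: "centre p \<in> M" and pn: "lev p = n" using centre by (auto simp: level_def)
    obtain q where q: "q \<in> E" "mball (centre p) \<delta> \<subseteq> oball q" using \<delta>(2)[OF pM] by blast
    have "(p', q) \<in> ball_order" if p': "p' \<in> level n" and "oball p \<inter> oball p' \<noteq> {}" for p'
    proof -
      obtain z where z: "z \<in> oball p" "z \<in> oball p'"
        using \<open>oball p \<inter> oball p' \<noteq> {}\<close> by blast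
      have p'n: "p' \<in> I" "lev p' = n" using p' by (auto simp: level_def)
      show ?thesis
        by (rule ball_order_nearI[of p' q "centre p" \<delta> z])
          (use p'n q E D levE pM n z pn in \<open>auto simp: oball_def\<close>)
    qed
    then show "\<exists>q\<in>D. \<forall>p'\<in>level n. oball p \<inter> oball p' \<noteq> {} \<longrightarrow> (p', q) \<in> ball_order"
      using q(1) E(2) by blast
  qed
qed

lemma cap_iff_cover: "cap ball_order D \<longleftrightarrow> D \<subseteq> I \<and> M \<subseteq> \<Union>(oball ` D)"
proof
  assume D: "cap ball_order D"
  then obtain B where B: "band ball_order B" "refines ball_order B D"
    by (auto simp: cap_def)
  have B': "finite B" "\<And>p. p \<in> I \<Longrightarrow> \<exists>b\<in>B. (p, b) \<in> ball_order \<or> (b, p) \<in> ball_order"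
    using B(1) by (auto simp: band_def Field_ball_order)
  obtain n where n: "Max (insert 0 (lev ` B)) < n" by (rule eps_small[of 1]) auto
  have levB: "lev b < n" if "b \<in> B" for b
    using n B'(1) that by (simp add: Max_less_iff)
  have "M \<subseteq> \<Union>(oball ` D)"
  proof
    fix x assume x: "x \<in> M"
    obtain p where p: "p \<in> level n" "x \<in> oball p" by (rule level_covers[OF x])
    then obtain b where b: "b \<in> B" "(p, b) \<in> ball_order \<or> (b, p) \<in> ball_order"
      using B'(2)[of p] by (auto simp: level_def)
    then have "(p, b) \<in> ball_order"
      using levB[OF b(1)] p by (auto simp: ball_order_def level_def)
    then have "x \<in> oball b" using p(2) ball_order_oball by blast
    moreover obtain t where t: "t \<in> D" "(b, t) \<in> ball_order"
      using B(2) b(1) unfolding refines_def by blast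
    ultimately have "x \<in> oball t" using ball_order_oball[OF t(2)] by blast
    then show "x \<in> \<Union>(oball ` D)" using t(1) by blast
  qed
  then show "D \<subseteq> I \<and> M \<subseteq> \<Union>(oball ` D)"
    using D by (simp add: cap_def Field_ball_order)
next
  assume D: "D \<subseteq> I \<and> M \<subseteq> \<Union>(oball ` D)"
  obtain n where n: "\<And>p. p \<in> level n \<Longrightarrow>
      \<exists>q\<in>D. \<forall>p'\<in>level n. oball p \<inter> oball p' \<noteq> {} \<longrightarrow> (p', q) \<in> ball_order"
    using D by (auto intro: cover_star_refined_by_level)
  have "\<exists>q\<in>D. (p, q) \<in> ball_order" if p: "p \<in> level n" for p
    using n[OF p] p centre_in_oball[of p] level_subset by blast
  then have "refines ball_order (level n) D" by (simp add: refines_def)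
  then show "cap ball_order D"
    using band_level D by (auto simp: cap_def Field_ball_order)
qed

definition nhd_balls :: "'b \<Rightarrow> 'a set" where
  "nhd_balls x = {p \<in> I. x \<in> oball p}"

text \<open>Any selector inside \<open>nhd_balls x\<close> contains arbitrarily small balls around \<open>x\<close>, and these lie
  below every given \<open>p \<in> nhd_balls x\<close>.\<close>

lemma nhd_balls_in_spectrum:
  assumes x: "x \<in> M"
  shows "nhd_balls x \<in> spectrum ball_order"
proof -
  have "selector ball_order (nhd_balls x)"
    unfolding selector_def cap_iff_cover Field_ball_order nhd_balls_def using x by blast
  then obtain T where "minimal_selector ball_order T" and sub: "T \<subseteq> nhd_balls x"
    by (rule selector_contains_minimal_selector)
  then have T: "T \<in> spectrum ball_order" by (simp add: spectrum_def)
  have "nhd_balls x \<subseteq> T"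
  proof
    fix p assume "p \<in> nhd_balls x"
    then have p: "p \<in> I" "x \<in> oball p" by (auto simp: nhd_balls_def)
    obtain \<delta> where \<delta>: "0 < \<delta>" "mball x \<delta> \<subseteq> oball p"
      using openin_oball p(2) unfolding openin_mtopology by blast
    obtain n where n: "lev p < n" "4 * \<epsilon> n < \<delta>" by (rule eps_small[OF \<delta>(1)])
    obtain t where t: "t \<in> level n" "t \<in> T" using spectrum_meets_cap[OF T cap_level] by blast
    have "(t, p) \<in> ball_order"
      by (rule ball_order_nearI[of t p x \<delta> x])
        (use t sub p x \<delta> n eps_pos in \<open>auto simp: level_def nhd_balls_def\<close>)
    then show "p \<in> T" by (rule spectrum_up_closed[OF T t(2)])
  qed
  then show ?thesis using T sub by (simp add: subset_antisym)
qed

text \<open>If \<open>S\<close> contained no \<open>nhd_balls x\<close>, then the complement of \<open>S\<close> would cover the space and thus be a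
  cap.\<close>

lemma spectrum_is_nhd_balls:
  assumes S: "S \<in> spectrum ball_order"
  shows "\<exists>x\<in>M. S = nhd_balls x"
proof -
  have "\<exists>x\<in>M. nhd_balls x \<subseteq> S"
  proof (rule ccontr)
    assume "\<not> (\<exists>x\<in>M. nhd_balls x \<subseteq> S)"
    then have "cap ball_order (I - S)"
      unfolding cap_iff_cover nhd_balls_def by blast
    then show False using spectrum_meets_cap[OF S] by blast
  qed
  then show ?thesis using spectrum_antichain[OF S] nhd_balls_in_spectrum by blast
qed

lemma regular_prime_omega_ball_order: "regular_prime_omega ball_order"
proof unfold_locales
  show "prime_poset ball_order"
    unfolding prime_poset_def Field_ball_order
    using nhd_balls_in_spectrum centre centre_in_oball
    by (force simp: spectrum_def nhd_balls_def)
  show "regular_poset ball_order"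
    unfolding regular_poset_def
  proof (intro allI impI)
    fix D assume "cap ball_order D"
    then have D: "D \<subseteq> I" "M \<subseteq> \<Union>(oball ` D)" by (auto simp: cap_iff_cover)
    obtain n where n: "\<And>p. p \<in> level n \<Longrightarrow>
        \<exists>q\<in>D. \<forall>p'\<in>level n. oball p \<inter> oball p' \<noteq> {} \<longrightarrow> (p', q) \<in> ball_order"
      using D by (auto intro: cover_star_refined_by_level)
    have meet: "oball p \<inter> oball p' \<noteq> {}" if m: "meets ball_order p' p" for p p'
    proof -
      obtain r where r: "(r, p') \<in> ball_order" "(r, p) \<in> ball_order"
        using m by (auto simp: meets_def)
      then have "centre r \<in> oball r" using centre_in_oball by (simp add: ball_order_def)
      then show ?thesis using r[THEN ball_order_oball] by blast
    qed
    have "\<exists>q\<in>D. (q, p) \<in> star_above ball_order" if p: "p \<in> level n" for p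
    proof -
      obtain q where q: "q \<in> D"
        "\<forall>p'\<in>level n. oball p \<inter> oball p' \<noteq> {} \<longrightarrow> (p', q) \<in> ball_order"
        using n[OF p] by blast
      have "\<forall>c\<in>cap_star ball_order (level n) p. (c, q) \<in> ball_order"
        using q(2) meet by (auto simp: cap_star_def)
      then show ?thesis
        using q(1) D(1) p cap_level subsetD[OF level_subset p]
        by (intro bexI[of _ q]) (auto simp: star_above_def Field_ball_order)
    qed
    then show "\<exists>C. cap ball_order C \<and> (\<forall>c\<in>C. \<exists>d\<in>D. (d, c) \<in> star_above ball_order)"
      using cap_level by blast
  qed
qed

lemma homeomorphic_spectrum: "spectrum_topology ball_order homeomorphic_space mtopology"
proof -
  have "homeomorphic_map mtopology (spectrum_topology ball_order) nhd_balls"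
  proof (rule continuous_imp_homeomorphic_map)
    show "compact_space mtopology" by (rule comp)
    show "Hausdorff_space (spectrum_topology ball_order)"
      by (rule regular_prime_omega.Hausdorff_spectrum[OF regular_prime_omega_ball_order])
    show "continuous_map mtopology (spectrum_topology ball_order) nhd_balls"
      unfolding spectrum_topology_def
    proof (rule continuous_on_generated_topo)
      fix U assume "U \<in> insert (spectrum ball_order) (spectrum_nhd ball_order ` Field ball_order)"
      then consider "U = spectrum ball_order" | p where "p \<in> I" "U = spectrum_nhd ball_order p"
        by (auto simp: Field_ball_order)
      then show "openin mtopology (nhd_balls -` U \<inter> topspace mtopology)"
      proof cases
        case 1
        then have "nhd_balls -` U \<inter> topspace mtopology = topspace mtopology"
          using nhd_balls_in_spectrum by auto
        then show ?thesis by simp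
      next
        case 2
        then have "nhd_balls -` U \<inter> topspace mtopology = oball p"
          using nhd_balls_in_spectrum oball_subset by (auto simp: spectrum_nhd_def nhd_balls_def)
        then show ?thesis using openin_oball by simp
      qed
    qed (use nhd_balls_in_spectrum in auto)
    show "nhd_balls ` topspace mtopology = topspace (spectrum_topology ball_order)"
      using nhd_balls_in_spectrum spectrum_is_nhd_balls by (auto simp: topspace_spectrum)
    show "inj_on nhd_balls (topspace mtopology)"
    proof (rule inj_onI, rule ccontr)
      fix x y assume xy: "x \<in> topspace mtopology" "y \<in> topspace mtopology" "nhd_balls x = nhd_balls y"
        "x \<noteq> y"
      then have "0 < d x y" by simp
      then obtain n where n: "4 * \<epsilon> n < d x y" by (rule eps_small[of _ 0])
      obtain p where p: "p \<in> level n" "x \<in> oball p" using level_covers xy(1) by auto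
      then have "y \<in> oball p" using xy(3) by (auto simp: nhd_balls_def level_def)
      then have "d (centre p) x < \<epsilon> n" "d (centre p) y < \<epsilon> n" "centre p \<in> M"
        using p by (auto simp: oball_def level_def)
      moreover have "d x y \<le> d x (centre p) + d (centre p) y"
        using xy \<open>centre p \<in> M\<close> by (intro triangle) auto
      ultimately show False using n eps_pos[of n] by (simp add: commute)
    qed
  qed
  then show ?thesis
    using homeomorphic_map_imp_homeomorphic_space homeomorphic_space_sym by blast
qed

end

text \<open>Each radius is chosen below a Lebesgue number of the cover by balls of the preceding radius, which
  yields the last property.\<close>

lemma (in Metric_space) exists_nets:
  assumes comp: "compact_space mtopology"
  obtains \<epsilon> :: "nat \<Rightarrow> real" and F :: "nat \<Rightarrow> 'a set"
  where "\<And>n. 0 < \<epsilon> n" "\<And>n. 3 * \<epsilon> (Suc n) \<le> \<epsilon> n" "\<And>n. finite (F n)" "\<And>n. F n \<subseteq> M"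
    "\<And>n x. x \<in> M \<Longrightarrow> \<exists>y\<in>F n. mcball x (\<epsilon> (Suc n)) \<subseteq> mball y (\<epsilon> n)"
proof -
  have net: "\<exists>F. finite F \<and> F \<subseteq> M \<and> M \<subseteq> (\<Union>x\<in>F. mball x e)" if "0 < e" for e
  proof -
    have "compactin mtopology M" using comp by (simp add: compact_space_def)
    moreover have "M \<subseteq> \<Union>((\<lambda>x. mball x e) ` M)" using that by fastforce
    ultimately obtain \<F> where "finite \<F>" "\<F> \<subseteq> (\<lambda>x. mball x e) ` M" "M \<subseteq> \<Union>\<F>"
      using compactinD[of mtopology M "(\<lambda>x. mball x e) ` M"] by auto
    then show ?thesis using finite_subset_image by metis
  qed
  define good where "good = (\<lambda>(e::real, F). 0 < e \<and> finite F \<and> F \<subseteq> M \<and> M \<subseteq> (\<Union>x\<in>F. mball x e))"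
  define step where "step = (\<lambda>(e::real, F) (e'::real, F'::'a set). 3 * e' \<le> e \<and>
      (\<forall>x\<in>M. \<exists>y\<in>F. mcball x e' \<subseteq> mball y e))"
  have "\<exists>f. \<forall>n. good (f n) \<and> step (f n) (f (Suc n))"
  proof (rule dependent_nat_choice)
    obtain F where "finite F" "F \<subseteq> M" "M \<subseteq> (\<Union>x\<in>F. mball x 1)" using net[of 1] by auto
    then have "good (1, F)" by (simp add: good_def)
    then show "\<exists>s. good s" by blast
    fix s :: "real \<times> 'a set" and n :: nat assume s: "good s"
    obtain e F where eF: "s = (e, F)" by (cases s)
    with s have F: "0 < e" "M \<subseteq> \<Union>((\<lambda>x. mball x e) ` F)" by (auto simp: good_def)
    obtain \<delta> where \<delta>: "0 < \<delta>" "\<And>x. x \<in> M \<Longrightarrow> \<exists>U\<in>(\<lambda>x. mball x e) ` F. mball x \<delta> \<subseteq> U"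
      by (rule compact_has_Lebesgue_number[OF comp _ F(2)]) auto
    define e' where "e' = min (\<delta> / 2) (e / 3)"
    have e': "0 < e'" "e' < \<delta>" "3 * e' \<le> e" using \<delta>(1) F(1) by (auto simp: e'_def min_def)
    obtain F' where "good (e', F')" using net[OF e'(1)] e'(1) by (auto simp: good_def)
    moreover have "mcball x e' \<subseteq> mball x \<delta>" for x using e'(2) by auto
    then have "\<exists>y\<in>F. mcball x e' \<subseteq> mball y e" if "x \<in> M" for x
      using \<delta>(2)[OF that] by (auto intro: order_trans)
    then have "step s (e', F')"
      using e'(3) by (simp add: step_def eF)
    ultimately show "\<exists>t. good t \<and> step s t" by blast
  qed
  then obtain f where f: "\<And>n. good (f n)" "\<And>n. step (f n) (f (Suc n))" by blast
  show thesis
  proof (rule that[of "\<lambda>n. fst (f n)" "\<lambda>n. snd (f n)"])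
    fix n
    show "0 < fst (f n)" "finite (snd (f n))" "snd (f n) \<subseteq> M"
      using f(1)[of n] by (auto simp: good_def split_beta)
    show "3 * fst (f (Suc n)) \<le> fst (f n)"
      using f(2)[of n] by (auto simp: step_def split_beta)
    show "\<exists>y\<in>snd (f n). mcball x (fst (f (Suc n))) \<subseteq> mball y (fst (f n))" if "x \<in> M" for x
      using f(2)[of n] that by (auto simp: step_def split_beta)
  qed
qed

lemma countable_inj_into_infinite:
  assumes "infinite (UNIV :: 'a set)" "countable J"
  obtains g :: "'b \<Rightarrow> 'a" where "inj_on g J"
proof -
  obtain f :: "nat \<Rightarrow> 'a" where "inj f"
    using infinite_countable_subset[OF assms(1)] by blast
  then have "inj_on (f \<circ> to_nat_on J) J"
    using assms(2) by (intro comp_inj_on) (auto intro: inj_on_to_nat_on inj_on_subset)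
  then show thesis by (rule that)
qed

lemma compact_metrizable_homeomorphic_spectrum:
  fixes X :: "'b topology"
  assumes inf: "infinite (UNIV :: 'a set)" and comp: "compact_space X" and metr: "metrizable_space X"
  shows "\<exists>P :: 'a rel. regular_prime_omega P \<and> spectrum_topology P homeomorphic_space X"
proof -
  obtain M d where "Metric_space M d" and X: "X = Metric_space.mtopology M d"
    using metr by (auto simp: metrizable_space_def)
  then interpret Metric_space M d by simp
  have comp': "compact_space mtopology" using comp X by simp
  obtain \<epsilon> F where nets: "\<And>n. 0 < \<epsilon> n" "\<And>n. 3 * \<epsilon> (Suc n) \<le> \<epsilon> n" "\<And>n. finite (F n)" "\<And>n. F n \<subseteq> M"
    "\<And>n x. x \<in> M \<Longrightarrow> \<exists>y\<in>F n. mcball x (\<epsilon> (Suc n)) \<subseteq> mball y (\<epsilon> n)"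
    using exists_nets[OF comp'] by metis
  define J where "J = (SIGMA n:UNIV. F n)"
  have "countable J"
    unfolding J_def using nets(3) by (intro countable_SIGMA) (auto intro: countable_finite)
  then obtain g :: "nat \<times> 'b \<Rightarrow> 'a" where g: "inj_on g J"
    using countable_inj_into_infinite[OF inf] by blast
  let ?h = "inv_into J g"
  have h: "?h (g j) = j" if "j \<in> J" for j using g that by simp
  interpret ball_levels M d "g ` J" "\<lambda>p. fst (?h p)" "\<lambda>p. snd (?h p)" \<epsilon>
  proof unfold_locales
    show "snd (?h p) \<in> M" if "p \<in> g ` J" for p
      using that h nets(4) by (force simp: J_def)
    show "finite {p \<in> g ` J. fst (?h p) = n}" for n
    proof (rule finite_subset)
      show "{p \<in> g ` J. fst (?h p) = n} \<subseteq> g ` ({n} \<times> F n)"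
        using h by (auto simp: J_def)
    qed (use nets(3) in auto)
    show "\<exists>p\<in>g ` J. fst (?h p) = n \<and> mcball x (\<epsilon> (Suc n)) \<subseteq> mball (snd (?h p)) (\<epsilon> n)"
      if x: "x \<in> M" for x n
    proof -
      obtain y where y: "y \<in> F n" "mcball x (\<epsilon> (Suc n)) \<subseteq> mball y (\<epsilon> n)" using nets(5)[OF x] by blast
      then have "(n, y) \<in> J" by (simp add: J_def)
      then show ?thesis using h y(2) by (intro bexI[of _ "g (n, y)"]) auto
    qed
  qed (use comp' nets in auto)
  show ?thesis
    using regular_prime_omega_ball_order homeomorphic_spectrum X by blast
qed

lemma homeomorphic_imp_isomorphic_obs:
  assumes "X homeomorphic_space Y"
  shows "isomorphic_obs cat_K X Y"
proof -
  obtain f g where fg: "homeomorphic_maps X Y f g"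
    using assms by (auto simp: homeomorphic_space_def)
  then have f: "continuous_map X Y f" and g: "continuous_map Y X g"
    and gf: "\<And>x. x \<in> topspace X \<Longrightarrow> g (f x) = x" and fg': "\<And>y. y \<in> topspace Y \<Longrightarrow> f (g y) = y"
    by (auto simp: homeomorphic_maps_def)
  have im: "\<And>x. x \<in> topspace X \<Longrightarrow> f x \<in> topspace Y" "\<And>y. y \<in> topspace Y \<Longrightarrow> g y \<in> topspace X"
    using f g by (auto simp: continuous_map_def)
  show ?thesis
    unfolding isomorphic_obs_def
  proof (intro bexI conjI)
    show "restrict f (topspace X) \<in> hom cat_K X Y" "restrict g (topspace Y) \<in> hom cat_K Y X"
      using f g by (auto simp: cat_K_def intro: continuous_map_eq)
    show "composite cat_K X Y X (restrict g (topspace Y)) (restrict f (topspace X)) = ident cat_K X"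
      "composite cat_K Y X Y (restrict f (topspace X)) (restrict g (topspace Y)) = ident cat_K Y"
      using im gf fg' by (auto simp: cat_K_def compose_def fun_eq_iff)
  qed
qed

lemma essentially_surjective_S:
  assumes "infinite (UNIV :: 'a set)"
  shows "essentially_surjective (cat_S :: ('a rel, 'a rel) category) cat_K functor_S"
  unfolding essentially_surjective_def
proof
  fix X :: "'a set topology" assume "X \<in> obs cat_K"
  then obtain P :: "'a rel" where "regular_prime_omega P" "spectrum_topology P homeomorphic_space X"
    using compact_metrizable_homeomorphic_spectrum[OF assms, of X] by (auto simp: cat_K_def)
  then show "\<exists>P\<in>obs (cat_S :: ('a rel, 'a rel) category). isomorphic_obs cat_K (on_ob functor_S P) X"
    using homeomorphic_imp_isomorphic_obs
    by (intro bexI[of _ P]) (auto simp: functor_S_def obs_cat_S)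
qed

theorem theorem3p25:
  assumes "infinite (UNIV :: 'a set)"
  shows "is_functor (cat_S :: ('a rel, 'a rel) category) cat_K functor_S \<and>
    full (cat_S :: ('a rel, 'a rel) category) cat_K functor_S \<and>
    faithful (cat_S :: ('a rel, 'a rel) category) functor_S \<and>
    essentially_surjective (cat_S :: ('a rel, 'a rel) category) cat_K functor_S \<and>
    (\<forall>X :: 'b topology. compact_space X \<and> metrizable_space X \<longrightarrow>
           (\<exists>P \<in> obs (cat_S :: ('a rel, 'a rel) category).
              on_ob functor_S P homeomorphic_space X)) \<and>
    is_functor (cat_P :: ('a rel, 'a rel) category) cat_S functor_Q \<and>
    is_functor (cat_P :: ('a rel, 'a rel) category) cat_K functor_S \<and>
    functor_eq (cat_P :: ('a rel, 'a rel) category) functor_S (functor_comp functor_S functor_Q)"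
proof (intro conjI allI impI)
  fix X :: "'b topology" assume "compact_space X \<and> metrizable_space X"
  then obtain P :: "'a rel" where "regular_prime_omega P" "spectrum_topology P homeomorphic_space X"
    using compact_metrizable_homeomorphic_spectrum[OF assms, of X] by blast
  then show "\<exists>P\<in>obs (cat_S :: ('a rel, 'a rel) category). on_ob functor_S P homeomorphic_space X"
    by (intro bexI[of _ P]) (auto simp: functor_S_def obs_cat_S)
qed (rule is_functor_S_cat_S full_S faithful_S essentially_surjective_S[OF assms]
    is_functor_Q is_functor_S_cat_P functor_S_factors)+

end
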